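(* Let $R\ge 2$ be a real number and let a linear regression model belong to $\mathcal{LM}(R)$. Let $\mathbf{\Gamma}_n$ be an admissible normalization with associated matrix $\mathbf{V}$. Let $k\ge1$, let $\boldsymbol{\alpha}_1,\ldots,\boldsymbol{\alpha}_k\in\mathbb{R}^p\setminus\{\boldsymbol{0}\}$, put $\mathbf{A}=(\boldsymbol{\alpha}_1,\ldots,\boldsymbol{\alpha}_k)^T$ and $\xi_{n,j}=\boldsymbol{\alpha}_j^T\mathbf{\Gamma}_n(\boldsymbol{b}_n-\boldsymbol{\beta})$, $j=1,\ldots,k$, and let $\boldsymbol{\xi}=(\xi_1,\ldots,\xi_k)^T\sim N_k(\boldsymbol{0},\sigma^2\mathbf{A}\mathbf{V}\mathbf{A}^T)$. Then for all real $r_1,\ldots,r_k\ge0$ with $r_1+\cdots+r_k<R$ the sequence of random variables $\prod_{j=1}^k|\xi_{n,j}|^{r_j}$ is uniformly integrable, and consequently $$\mathbb{E}\prod_{j=1}^k|\xi_{n,j}|^{r_j}\to\mathbb{E}\prod_{j=1}^k|\xi_j|^{r_j}\quad\text{as } n\to\infty;$$ and if $r_1,\ldots,r_k$ are nonnegative integers, $$\mathbb{E}\prod_{j=1}^k\xi_{n,j}^{r_j}\to\mathbb{E}\prod_{j=1}^k\xi_j^{r_j}\quad\text{as } n\to\infty.$$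
   Context: Linear regression model. Fix an integer $p\ge1$, a parameter $\boldsymbol{\beta}\in\mathbb{R}^p$, a sequence of nonrandom vectors $\boldsymbol{x}_1,\boldsymbol{x}_2,\ldots\in\mathbb{R}^p$, and independent (not necessarily identically distributed) real random variables $\varepsilon_1,\varepsilon_2,\ldots$ with $\mathbb{E}(\varepsilon_i)=0$, $\mathrm{Var}(\varepsilon_i)=\sigma^2<\infty$ (the same for all $i$), and distribution functions $F_i$. For each $n$ let $\mathbf{X}_n=(\boldsymbol{x}_1,\ldots,\boldsymbol{x}_n)^T\in\mathbb{R}^{n\times p}$ and $\boldsymbol{Y}=\mathbf{X}_n\boldsymbol{\beta}+(\varepsilon_1,\ldots,\varepsilon_n)^T$. When $\mathrm{rank}(\mathbf{X}_n)=p$ the ordinary least squares estimator is $\boldsymbol{b}_n=(\mathbf{X}_n^T\mathbf{X}_n)^{-1}\mathbf{X}_n^T\boldsymbol{Y}$. Put $\mathbf{M}_n=(m_{ij;n})=\mathbf{X}_n^T\mathbf{X}_n$ and $\mathbf{D}_n=\mathrm{diag}(\sqrt{m_{11;n}},\ldots,\sqrt{m_{pp;n}})$; let $x_{i;n}$ denote the $i$-th component of $\boldsymbol{x}_n$. Assumptions: (i) $m_{ii;n}\to\infty$ as $n\to\infty$, $i=1,\ldots,p$; (ii) $x_{i;n+1}^2/m_{ii;n}\to0$ as $n\to\infty$, $i=1,\ldots,p$; (iii) $\mathbf{D}_n^{-1}\mathbf{M}_n\mathbf{D}_n^{-1}\to\mathbf{V}^{-1}$ as $n\to\infty$, with $\mathbf{V}^{-1}$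 nonsingular; (iii$'$) $n^{-1}\mathbf{X}_n^T\mathbf{X}_n\to\mathbf{V}^{-1}$ as $n\to\infty$, with $\mathbf{V}^{-1}\in\mathbb{R}^{p\times p}$ nonsingular; (iv) $\sup_{i\ge1}\int_{|u|>c}u^2\,dF_i(u)\to0$ as $c\to\infty$. For $R>0$, $\mathcal{LM}(R)$ is the family of such models for which either (i)–(iv) hold or (iii$'$) and (iv) hold, and $\sup_{i\ge1}\mathbb{E}|\varepsilon_i|^R<\infty$. Admissible normalization: $\mathbf{\Gamma}_n=\mathbf{D}_n$ if (i)–(iv) hold, with $\mathbf{V}$ from (iii); or $\mathbf{\Gamma}_n=\sqrt{n}\,\mathbf{I}_p$ if (iii$'$), (iv) hold, with $\mathbf{V}$ from (iii$'$). In either case $\mathbf{X}_n$ has rank $p$ for all sufficiently large $n$, and sequences indexed by $n$ are considered for those $n$ with $\mathrm{rank}(\mathbf{X}_n)=p$. It is known that $\mathbf{\Gamma}_n(\boldsymbol{b}_n-\boldsymbol{\beta})$ converges in distribution to $N_p(\boldsymbol{0},\sigma^2\mathbf{V})$. Convention: $0^0=1$. *)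

theory Defs
  imports "HOL-Probability.Probability"
begin

text \<open>
  The number of regressors is \<open>CARD('p)\<close>. Sequences of regressors and errors are indexed by the
  positive integers; the values at index 0 play no role. The design matrix
  \<open>X\<^sub>n\<close> has rows \<open>x 1, \<dots>, x n\<close>; since its number of rows varies with \<open>n\<close>, it is represented by
  the sequence \<open>x\<close> itself, and the products \<open>X\<^sub>n\<^sup>T X\<^sub>n\<close> and \<open>X\<^sub>n\<^sup>T Y\<close> are written out as sums over the rows.
\<close>

definition design_rank :: "(nat \<Rightarrow> real ^ 'p) \<Rightarrow> nat \<Rightarrow> nat" where
  "design_rank x n = dim (x ` {1..n})"

definition gram :: "(nat \<Rightarrow> real ^ 'p) \<Rightarrow> nat \<Rightarrow> real ^ 'p ^ 'p" where
  "gram x n = (\<chi> i j. \<Sum>k = 1..n. x k $ i * x k $ j)"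

definition diag_norm :: "(nat \<Rightarrow> real ^ 'p) \<Rightarrow> nat \<Rightarrow> real ^ 'p ^ 'p" where
  "diag_norm x n = (\<chi> i j. if i = j then sqrt (gram x n $ i $ i) else 0)"

definition response ::
  "real ^ 'p \<Rightarrow> (nat \<Rightarrow> real ^ 'p) \<Rightarrow> (nat \<Rightarrow> 'a \<Rightarrow> real) \<Rightarrow> nat \<Rightarrow> 'a \<Rightarrow> real" where
  "response \<beta> x \<epsilon> k \<omega> = x k \<bullet> \<beta> + \<epsilon> k \<omega>"

text \<open>Meaningful for those \<open>n\<close> with \<open>design_rank x n = CARD('p)\<close>.\<close>

definition ols ::
  "real ^ 'p \<Rightarrow> (nat \<Rightarrow> real ^ 'p) \<Rightarrow> (nat \<Rightarrow> 'a \<Rightarrow> real) \<Rightarrow> nat \<Rightarrow> 'a \<Rightarrow> real ^ 'p" where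
  "ols \<beta> x \<epsilon> n \<omega> =
     matrix_inv (gram x n) *v (\<Sum>k = 1..n. response \<beta> x \<epsilon> k \<omega> *\<^sub>R x k)"

definition error_model :: "'a measure \<Rightarrow> (nat \<Rightarrow> 'a \<Rightarrow> real) \<Rightarrow> real \<Rightarrow> bool" where
  "error_model M \<epsilon> \<sigma> \<longleftrightarrow>
     prob_space M \<and>
     prob_space.indep_vars M (\<lambda>_. borel) \<epsilon> {1..} \<and>
     (\<forall>i\<ge>1. integrable M (\<epsilon> i) \<and> prob_space.expectation M (\<epsilon> i) = 0 \<and>
            integrable M (\<lambda>\<omega>. (\<epsilon> i \<omega>)\<^sup>2) \<and> prob_space.variance M (\<epsilon> i) = \<sigma>\<^sup>2)"

text \<open>In the two Gram matrix conditions the limit is the nonsingular matrix \<open>V\<^sup>-\<^sup>1\<close>;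
  \<open>invertible V\<close> is needed since \<open>matrix_inv\<close> is total.\<close>

definition diag_diverges :: "(nat \<Rightarrow> real ^ 'p) \<Rightarrow> bool" where
  "diag_diverges x \<longleftrightarrow> (\<forall>i. filterlim (\<lambda>n. gram x n $ i $ i) at_top sequentially)"

definition regressor_negligible :: "(nat \<Rightarrow> real ^ 'p) \<Rightarrow> bool" where
  "regressor_negligible x \<longleftrightarrow> (\<forall>i. (\<lambda>n. (x (n + 1) $ i)\<^sup>2 / gram x n $ i $ i) \<longlonglongrightarrow> 0)"

definition normalized_gram_limit :: "(nat \<Rightarrow> real ^ 'p) \<Rightarrow> real ^ 'p ^ 'p \<Rightarrow> bool" where
  "normalized_gram_limit x V \<longleftrightarrow> invertible V \<and>
     (\<lambda>n. matrix_inv (diag_norm x n) ** gram x n ** matrix_inv (diag_norm x n))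
       \<longlonglongrightarrow> matrix_inv V"

definition mean_gram_limit :: "(nat \<Rightarrow> real ^ 'p) \<Rightarrow> real ^ 'p ^ 'p \<Rightarrow> bool" where
  "mean_gram_limit x V \<longleftrightarrow> invertible V \<and>
     (\<lambda>n. (1 / real n) *\<^sub>R gram x n) \<longlonglongrightarrow> matrix_inv V"

definition tails_negligible :: "'a measure \<Rightarrow> (nat \<Rightarrow> 'a \<Rightarrow> real) \<Rightarrow> bool" where
  "tails_negligible M \<epsilon> \<longleftrightarrow>
     ((\<lambda>c::real. SUP i\<in>{1..}.
         \<integral>\<^sup>+ u. ennreal (u\<^sup>2) * indicator {u. \<bar>u\<bar> > c} u \<partial>distr M borel (\<epsilon> i)) \<longlongrightarrow> 0) at_top"

definition admissible_diag ::
  "'a measure \<Rightarrow> (nat \<Rightarrow> real ^ 'p) \<Rightarrow> (nat \<Rightarrow> 'a \<Rightarrow> real) \<Rightarrow> real ^ 'p ^ 'p \<Rightarrow> bool" where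
  "admissible_diag M x \<epsilon> V \<longleftrightarrow>
     diag_diverges x \<and> regressor_negligible x \<and> normalized_gram_limit x V \<and> tails_negligible M \<epsilon>"

definition admissible_mean ::
  "'a measure \<Rightarrow> (nat \<Rightarrow> real ^ 'p) \<Rightarrow> (nat \<Rightarrow> 'a \<Rightarrow> real) \<Rightarrow> real ^ 'p ^ 'p \<Rightarrow> bool" where
  "admissible_mean M x \<epsilon> V \<longleftrightarrow> mean_gram_limit x V \<and> tails_negligible M \<epsilon>"

definition in_LM ::
  "real \<Rightarrow> 'a measure \<Rightarrow> (nat \<Rightarrow> real ^ 'p) \<Rightarrow> (nat \<Rightarrow> 'a \<Rightarrow> real) \<Rightarrow> real \<Rightarrow> bool" where
  "in_LM R M x \<epsilon> \<sigma> \<longleftrightarrow>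
     R > 0 \<and> error_model M \<epsilon> \<sigma> \<and>
     ((\<exists>V. admissible_diag M x \<epsilon> V) \<or> (\<exists>V. admissible_mean M x \<epsilon> V)) \<and>
     (SUP i\<in>{1..}. \<integral>\<^sup>+ \<omega>. ennreal (\<bar>\<epsilon> i \<omega>\<bar> powr R) \<partial>M) < \<infinity>"

definition admissible_normalization ::
  "'a measure \<Rightarrow> (nat \<Rightarrow> real ^ 'p) \<Rightarrow> (nat \<Rightarrow> 'a \<Rightarrow> real) \<Rightarrow>
   (nat \<Rightarrow> real ^ 'p ^ 'p) \<Rightarrow> real ^ 'p ^ 'p \<Rightarrow> bool" where
  "admissible_normalization M x \<epsilon> \<Gamma> V \<longleftrightarrow>
     (admissible_diag M x \<epsilon> V \<and> (\<forall>n. \<Gamma> n = diag_norm x n)) \<or>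
     (admissible_mean M x \<epsilon> V \<and> (\<forall>n. \<Gamma> n = mat (sqrt (real n))))"

text \<open>The (possibly degenerate) normal law \<open>N(\<mu>, S)\<close>, determined by its characteristic function.
  Positive semidefiniteness of \<open>S\<close> is implied, as a characteristic function is bounded by 1.\<close>

definition multivariate_normal ::
  "(real ^ 'k) measure \<Rightarrow> real ^ 'k \<Rightarrow> real ^ 'k ^ 'k \<Rightarrow> bool" where
  "multivariate_normal P \<mu> S \<longleftrightarrow>
     prob_space P \<and> sets P = sets borel \<and> transpose S = S \<and>
     (\<forall>t. (CLINT y|P. iexp (t \<bullet> y)) =
          iexp (t \<bullet> \<mu>) * exp (complex_of_real (- (t \<bullet> (S *v t)) / 2)))"

definition uniformly_integrable :: "'a measure \<Rightarrow> nat set \<Rightarrow> (nat \<Rightarrow> 'a \<Rightarrow> real) \<Rightarrow> bool" where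
  "uniformly_integrable M I Z \<longleftrightarrow>
     (\<forall>n\<in>I. Z n \<in> borel_measurable M) \<and>
     ((\<lambda>c::real. SUP n\<in>I.
         \<integral>\<^sup>+ \<omega>. ennreal \<bar>Z n \<omega>\<bar> * indicator {\<omega>. \<bar>Z n \<omega>\<bar> > c} \<omega> \<partial>M) \<longlongrightarrow> 0) at_top"

text \<open>\<open>|u|\<^sup>r\<close> for \<open>r \<ge> 0\<close> with \<open>0\<^sup>0 = 1\<close>, whereas \<open>0 powr 0 = 0\<close>.\<close>

definition abs_powr :: "real \<Rightarrow> real \<Rightarrow> real" where
  "abs_powr u r = (if r = 0 then 1 else \<bar>u\<bar> powr r)"

end

theory Submission
  imports Defs "HOL-Real_Asymp.Real_Asymp"
begin

text \<open>
  For \<open>n\<close> with \<open>X\<^sub>n\<close> of full rank, \<open>\<xi>\<^sub>n\<^sub>,\<^sub>j = \<Sum>\<^sub>i d\<^sub>n\<^sub>,\<^sub>j\<^sub>,\<^sub>i \<epsilon>\<^sub>i\<close> with nonrandom weights whose sum of squares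
  converges to \<open>\<alpha>\<^sub>j \<bullet> V \<alpha>\<^sub>j\<close>. A second-order Taylor expansion of \<open>(1 + s\<^sup>2)\<^bsup>R/2\<^esup>\<close>, with the
  linear term removed by independence and centring, gives a discrete Gronwall inequality and so a
  bound on the \<open>R\<close>-th moments uniform in \<open>n\<close>; uniform integrability of lower-order products follows.

  For the limit of the expectations, Lindeberg's argument yields the characteristic functions of
  \<open>(\<xi>\<^sub>n\<^sub>,\<^sub>1, \<dots>, \<xi>\<^sub>n\<^sub>,\<^sub>k)\<close>. To pass to a continuous \<open>f\<close> of polynomial growth, each coordinate \<open>y\<^sub>j\<close> is
  replaced by \<open>L sin (y\<^sub>j / L)\<close>: on the resulting cube \<open>f\<close> is a uniform limit of polynomials, which
  turn into trigonometric polynomials in \<open>y\<close>, and the error for large \<open>L\<close> is controlled by the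
  \<open>R\<close>-th moments. Fatou's lemma transfers the moment bound to the limit law, so no formula for
  Gaussian moments is needed.
\<close>

subsection \<open>Moments of weighted sums of independent variables\<close>

lemma abs_powr_square: "\<bar>x\<bar> powr r = (x\<^sup>2) powr (r/2)" for x :: real
proof (cases "x = 0")
  case False
  then have "(x\<^sup>2) powr (r/2) = (\<bar>x\<bar> powr 2) powr (r/2)" by simp
  then show ?thesis by (simp only: powr_powr) simp
qed simp

text \<open>The second derivative of \<open>(1 + u^2) powr (R/2)\<close> is at most
  \<open>R * (R - 1) * (1 + u^2) powr (R/2 - 1)\<close>. At the intermediate point \<open>t\<close>,
  \<open>1 + t^2\<close> is at most 4 times the larger of \<open>1 + s^2\<close> and
  \<open>x^2\<close>, so the remainder splits into a part with the weight at \<open>s\<close> and a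
  pure power of \<open>x\<close>. The added 1 keeps the function smooth at 0 and at least 1.\<close>

lemma one_plus_square_powr_taylor:
  fixes R s x :: real
  assumes "R \<ge> 2"
  shows "(1 + (s + x)\<^sup>2) powr (R/2) \<le> (1 + s\<^sup>2) powr (R/2) + R * s * (1 + s\<^sup>2) powr (R/2 - 1) * x
     + R * (R - 1) * 4 powr (R/2 - 1) * (x\<^sup>2 * (1 + s\<^sup>2) powr (R/2) + \<bar>x\<bar> powr R)"
proof (cases "x = 0")
  case True then show ?thesis by simp
next
  case False
  let ?b = "R/2 - 1"
  have b0: "?b \<ge> 0" using assms by simp
  define df where "df m = (if m = 0 then (\<lambda>u::real. (1 + u\<^sup>2) powr (R/2))
     else if m = (1::nat) then (\<lambda>u. R * u * (1 + u\<^sup>2) powr (R/2 - 1))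
     else (\<lambda>u. R * (1 + u\<^sup>2) powr (R/2 - 1) + R * (R - 2) * u\<^sup>2 * (1 + u\<^sup>2) powr (R/2 - 1 - 1)))" for m
  have pos: "1 + u\<^sup>2 > 0" for u :: real by (simp add: add_pos_nonneg)
  have D0: "DERIV (df 0) u :> df (Suc 0) u" for u
    unfolding df_def using pos[of u]
    by (auto intro!: derivative_eq_intros simp: field_simps)
  have D1: "DERIV (df 1) u :> df (Suc 1) u" for u
    unfolding df_def using pos[of u]
    by (auto intro!: derivative_eq_intros simp: field_simps power2_eq_square)
  have "\<forall>m t. m < 2 \<and> min s (s + x) \<le> t \<and> t \<le> max s (s + x) \<longrightarrow> DERIV (df m) t :> df (Suc m) t"
  proof (intro allI impI)
    fix m :: nat and t assume "m < 2 \<and> min s (s + x) \<le> t \<and> t \<le> max s (s + x)"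
    then have "m = 0 \<or> m = 1" by auto
    then show "DERIV (df m) t :> df (Suc m) t" using D0 D1 by auto
  qed
  \<comment> \<open>Taking the minimum and maximum of the two points covers both signs of
    \<open>x\<close>. The case \<open>x = 0\<close> was split off because the point of expansion
    must differ from the argument.\<close>
  from Taylor[of 2 df "df 0" "min s (s+x)" "max s (s+x)" s "s+x", OF _ _ this] False
  have "\<exists>t. (if s + x < s then s + x < t \<and> t < s else s < t \<and> t < s + x) \<and>
    df 0 (s + x) = (\<Sum>m<2. (df m s / fact m) * (s + x - s)^m) + (df 2 t / fact 2) * (s + x - s)^2"
    by simp
  then obtain t where t: "if s + x < s then s + x < t \<and> t < s else s < t \<and> t < s + x"
    and eq: "df 0 (s + x) = (\<Sum>m<2. (df m s / fact m) * (s + x - s)^m) + (df 2 t / fact 2) * (s + x - s)^2"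
    by blast
  have tle: "\<bar>t\<bar> \<le> \<bar>s\<bar> + \<bar>x\<bar>" using t by (auto split: if_splits)
  define T where "T = (1 + t\<^sup>2) powr ?b"
  define S where "S = (1 + s\<^sup>2) powr ?b"
  have T0: "T \<ge> 0" unfolding T_def by simp
  \<comment> \<open>The factor \<open>t^2 / (1 + t^2)\<close> is at most 1, so both terms of the
    second derivative become multiples of \<open>T\<close>, with coefficients \<open>R\<close> and
    \<open>R * (R - 2)\<close> that add up to \<open>R * (R - 1)\<close>.\<close>
  have "t\<^sup>2 * (1 + t\<^sup>2) powr (?b - 1) = t\<^sup>2 / (1 + t\<^sup>2) * T"
    unfolding T_def using pos[of t] by (simp add: powr_diff power2_eq_square[of "1 + t\<^sup>2"])
  also have "\<dots> \<le> 1 * T"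
    using T0 pos[of t] by (intro mult_right_mono) (auto simp: field_simps)
  finally have "R * (R - 2) * (t\<^sup>2 * (1 + t\<^sup>2) powr (?b - 1)) \<le> R * (R - 2) * T"
    using assms by (intro mult_left_mono) auto
  then have d2: "df 2 t \<le> R * (R - 1) * T"
    unfolding df_def by (simp add: T_def algebra_simps)
  have "t\<^sup>2 \<le> (\<bar>s\<bar> + \<bar>x\<bar>)\<^sup>2" using tle by (metis abs_ge_zero power2_abs power_mono)
  also have "\<dots> \<le> 2 * s\<^sup>2 + 2 * x\<^sup>2"
    using sum_squares_bound[of "\<bar>s\<bar>" "\<bar>x\<bar>"] by (simp add: power2_sum)
  finally have "1 + t\<^sup>2 \<le> 4 * max (1 + s\<^sup>2) (x\<^sup>2)"
    using zero_le_power2[of s] by (auto simp: max_def)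
  then have "T \<le> (4 * max (1 + s\<^sup>2) (x\<^sup>2)) powr ?b"
    unfolding T_def using b0 pos[of t] by (intro powr_mono2) auto
  also have "\<dots> = 4 powr ?b * (max (1 + s\<^sup>2) (x\<^sup>2)) powr ?b" by (simp add: powr_mult)
  also have "\<dots> \<le> 4 powr ?b * (S + (x\<^sup>2) powr ?b)"
    unfolding S_def by (intro mult_left_mono) (auto simp: max_def)
  finally have Tle: "T \<le> 4 powr ?b * (S + (x\<^sup>2) powr ?b)" .
  have xR: "x\<^sup>2 * (x\<^sup>2) powr ?b = \<bar>x\<bar> powr R"
  proof -
    have "x\<^sup>2 * (x\<^sup>2) powr ?b = (x\<^sup>2) powr (R/2)" using False by (simp add: powr_diff)
    also have "\<dots> = \<bar>x\<bar> powr R" by (rule abs_powr_square[symmetric])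
    finally show ?thesis .
  qed
  have SS: "S \<le> (1 + s\<^sup>2) powr (R/2)" unfolding S_def by (intro powr_mono) auto
  have "df 2 t * x\<^sup>2 \<le> R * (R - 1) * T * x\<^sup>2" using d2 by (intro mult_right_mono) auto
  also have "\<dots> \<le> R * (R - 1) * (4 powr ?b * (S + (x\<^sup>2) powr ?b)) * x\<^sup>2"
    using Tle assms by (intro mult_right_mono mult_left_mono) auto
  also have "\<dots> = R * (R - 1) * 4 powr ?b * (x\<^sup>2 * S + x\<^sup>2 * (x\<^sup>2) powr ?b)" by (simp add: algebra_simps)
  also have "\<dots> \<le> R * (R - 1) * 4 powr ?b * (x\<^sup>2 * (1 + s\<^sup>2) powr (R/2) + \<bar>x\<bar> powr R)"
    unfolding xR using SS assms by (intro mult_left_mono add_mono) auto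
  finally have *: "df 2 t * x\<^sup>2 \<le> R * (R - 1) * 4 powr ?b * (x\<^sup>2 * (1 + s\<^sup>2) powr (R/2) + \<bar>x\<bar> powr R)" .
  \<comment> \<open>The Taylor factor 1/2 is given away; the sign of the bound makes this
    harmless.\<close>
  have "0 \<le> R * (R - 1) * 4 powr ?b * (x\<^sup>2 * (1 + s\<^sup>2) powr (R/2) + \<bar>x\<bar> powr R)" using assms by auto
  with * have "df 2 t / 2 * x\<^sup>2 \<le> R * (R - 1) * 4 powr ?b * (x\<^sup>2 * (1 + s\<^sup>2) powr (R/2) + \<bar>x\<bar> powr R)"
    by linarith
  then show ?thesis using eq
    by (simp add: df_def eval_nat_numeral lessThan_Suc)
qed

text \<open>Induction on \<open>m\<close>: the Taylor bound is applied at the partial sum with the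
  next summand as increment. The linear term has mean zero by independence and centring, and the
  remainder multiplies the previous expectation by one factor of the product. Integrability is
  carried along because the product rule for independent variables needs it.\<close>

lemma (in prob_space) expectation_one_plus_square_powr_sum:
  fixes X :: "nat \<Rightarrow> 'a \<Rightarrow> real" and R :: real
  defines "C \<equiv> R * (R - 1) * 4 powr (R/2 - 1)"
  assumes R: "R \<ge> 2" and indep: "indep_vars (\<lambda>_. borel) X {1..}"
    and int1: "\<And>k. k \<ge> 1 \<Longrightarrow> integrable M (X k)" and mean: "\<And>k. k \<ge> 1 \<Longrightarrow> expectation (X k) = 0"
    and int2: "\<And>k. k \<ge> 1 \<Longrightarrow> integrable M (\<lambda>\<omega>. (X k \<omega>)\<^sup>2)"
    and intR: "\<And>k. k \<ge> 1 \<Longrightarrow> integrable M (\<lambda>\<omega>. \<bar>X k \<omega>\<bar> powr R)"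
  shows "integrable M (\<lambda>\<omega>. (1 + (\<Sum>k = 1..m. X k \<omega>)\<^sup>2) powr (R/2)) \<and>
    expectation (\<lambda>\<omega>. (1 + (\<Sum>k = 1..m. X k \<omega>)\<^sup>2) powr (R/2)) \<le>
      (\<Prod>k = 1..m. 1 + C * (expectation (\<lambda>\<omega>. (X k \<omega>)\<^sup>2) + expectation (\<lambda>\<omega>. \<bar>X k \<omega>\<bar> powr R)))"
proof (induction m)
  case 0
  then show ?case by (simp add: prob_space)
next
  case (Suc m)
  have rv[measurable]: "random_variable borel (X k)" if "k \<ge> 1" for k
    using int1[OF that] by (rule borel_measurable_integrable)
  define S where "S \<omega> = (\<Sum>k = 1..m. X k \<omega>)" for \<omega>
  define x where "x = X (Suc m)"
  have [measurable]: "x \<in> borel_measurable M" unfolding x_def by simp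
  have [measurable]: "S \<in> borel_measurable M" unfolding S_def by (intro borel_measurable_sum) auto
  have C0: "C \<ge> 0" unfolding C_def using R by simp
  define \<phi> where "\<phi> s = (1 + s\<^sup>2) powr (R/2)" for s :: real
  define \<psi> where "\<psi> s = R * s * (1 + s\<^sup>2) powr (R/2 - 1)" for s :: real
  have [measurable]: "\<phi> \<in> borel_measurable borel" "\<psi> \<in> borel_measurable borel"
    unfolding \<phi>_def \<psi>_def by measurable
  have \<phi>1: "\<phi> s \<ge> 1" for s unfolding \<phi>_def using R by (simp add: ge_one_powr_ge_zero)
  have \<psi>\<phi>: "\<bar>\<psi> s\<bar> \<le> R * \<phi> s" for s
  proof -
    have "\<bar>s\<bar> \<le> 1 + s\<^sup>2" using zero_le_power2[of "\<bar>s\<bar> - 1"] zero_le_power2[of s] by (simp add: power2_diff)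
    then have "\<bar>s\<bar> * (1 + s\<^sup>2) powr (R/2 - 1) \<le> (1 + s\<^sup>2) * (1 + s\<^sup>2) powr (R/2 - 1)"
      by (intro mult_right_mono) auto
    also have "\<dots> = \<phi> s" unfolding \<phi>_def
      by (simp add: powr_diff add_pos_nonneg less_imp_neq[THEN not_sym] add_nonneg_eq_0_iff)
    finally show ?thesis unfolding \<psi>_def using R by (simp add: abs_mult)
  qed
  have IH1: "integrable M (\<lambda>\<omega>. \<phi> (S \<omega>))" and IH2: "expectation (\<lambda>\<omega>. \<phi> (S \<omega>)) \<le>
      (\<Prod>k = 1..m. 1 + C * (expectation (\<lambda>\<omega>. (X k \<omega>)\<^sup>2) + expectation (\<lambda>\<omega>. \<bar>X k \<omega>\<bar> powr R)))"
    using Suc unfolding \<phi>_def S_def by auto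
  have int\<psi>: "integrable M (\<lambda>\<omega>. \<psi> (S \<omega>))"
    by (rule Bochner_Integration.integrable_bound[OF integrable_mult_right[OF IH1, of R]])
       (use \<psi>\<phi> R in \<open>auto simp: abs_mult intro!: AE_I2 order_trans[OF \<psi>\<phi>]\<close>)
  have ind: "indep_var borel x borel S"
    unfolding x_def S_def
    by (rule indep_vars_sum) (auto intro: indep_vars_subset[OF indep])
  have ind1: "indep_var borel (\<lambda>\<omega>. x \<omega>) borel (\<lambda>\<omega>. \<psi> (S \<omega>))"
    using indep_var_compose[OF ind, of "\<lambda>x. x" borel \<psi> borel] by (simp add: comp_def)
  have ind2: "indep_var borel (\<lambda>\<omega>. (x \<omega>)\<^sup>2) borel (\<lambda>\<omega>. \<phi> (S \<omega>))"
    using indep_var_compose[OF ind, of "\<lambda>x. x\<^sup>2" borel \<phi> borel] by (simp add: comp_def)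
  have i: "integrable M x" "integrable M (\<lambda>\<omega>. (x \<omega>)\<^sup>2)" "integrable M (\<lambda>\<omega>. \<bar>x \<omega>\<bar> powr R)"
    unfolding x_def using int1 int2 intR by auto
  note p1 = indep_var_integrable[OF ind1 i(1) int\<psi>]
  note p2 = indep_var_integrable[OF ind2 i(2) IH1]
  define h where "h \<omega> = \<phi> (S \<omega>) + x \<omega> * \<psi> (S \<omega>) + C * ((x \<omega>)\<^sup>2 * \<phi> (S \<omega>) + \<bar>x \<omega>\<bar> powr R)" for \<omega>
  have inth: "integrable M h" unfolding h_def using IH1 p1 p2 i by auto
  have le: "\<phi> (S \<omega> + x \<omega>) \<le> h \<omega>" for \<omega>
    using one_plus_square_powr_taylor[OF R, of "S \<omega>" "x \<omega>"] unfolding h_def \<phi>_def \<psi>_def C_def by (simp add: mult_ac)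
  have int: "integrable M (\<lambda>\<omega>. \<phi> (S \<omega> + x \<omega>))"
    by (rule Bochner_Integration.integrable_bound[OF inth])
       (use le \<phi>1 in \<open>auto intro!: AE_I2 simp: abs_of_nonneg order_trans[OF zero_le_one] intro: order_trans[OF _ abs_ge_self]\<close>)
  have "expectation (\<lambda>\<omega>. \<phi> (S \<omega> + x \<omega>)) \<le> expectation h"
    by (rule integral_mono[OF int inth]) (rule le)
  also have "\<dots> = expectation (\<lambda>\<omega>. \<phi> (S \<omega>)) + expectation x * expectation (\<lambda>\<omega>. \<psi> (S \<omega>)) +
     C * (expectation (\<lambda>\<omega>. (x \<omega>)\<^sup>2) * expectation (\<lambda>\<omega>. \<phi> (S \<omega>)) + expectation (\<lambda>\<omega>. \<bar>x \<omega>\<bar> powr R))"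
    unfolding h_def using IH1 p1 p2 i
    by (simp add: indep_var_lebesgue_integral[OF ind1 i(1) int\<psi>] indep_var_lebesgue_integral[OF ind2 i(2) IH1])
  \<comment> \<open>Centring removes the first-order term, leaving only terms of order 2 and
    \<open>R\<close> in \<open>x\<close>.\<close>
  also have "expectation x = 0" unfolding x_def by (simp add: mean)
  also have "expectation (\<lambda>\<omega>. \<phi> (S \<omega>)) + 0 * expectation (\<lambda>\<omega>. \<psi> (S \<omega>)) +
     C * (expectation (\<lambda>\<omega>. (x \<omega>)\<^sup>2) * expectation (\<lambda>\<omega>. \<phi> (S \<omega>)) + expectation (\<lambda>\<omega>. \<bar>x \<omega>\<bar> powr R)) \<le>
     expectation (\<lambda>\<omega>. \<phi> (S \<omega>)) + 0 * expectation (\<lambda>\<omega>. \<psi> (S \<omega>)) +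
     C * (expectation (\<lambda>\<omega>. (x \<omega>)\<^sup>2) * expectation (\<lambda>\<omega>. \<phi> (S \<omega>)) +
      expectation (\<lambda>\<omega>. \<bar>x \<omega>\<bar> powr R) * expectation (\<lambda>\<omega>. \<phi> (S \<omega>)))"
  proof -
    \<comment> \<open>Since \<open>\<phi>\<close> is at least 1, the additive term with the
      \<open>R\<close>-th moment may be multiplied by the expectation of \<open>\<phi>\<close> at
      the partial sum, which turns the recursion into a purely multiplicative one.\<close>
    have "1 \<le> expectation (\<lambda>\<omega>. \<phi> (S \<omega>))"
      using integral_mono[OF _ IH1, of "\<lambda>_. 1"] \<phi>1 by (simp add: prob_space)
    then have "expectation (\<lambda>\<omega>. \<bar>x \<omega>\<bar> powr R) * 1 \<le> expectation (\<lambda>\<omega>. \<bar>x \<omega>\<bar> powr R) * expectation (\<lambda>\<omega>. \<phi> (S \<omega>))"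
      by (intro mult_left_mono) auto
    then show ?thesis using C0 by (intro add_mono mult_left_mono) auto
  qed
  also have "\<dots> = expectation (\<lambda>\<omega>. \<phi> (S \<omega>)) * (1 + C * (expectation (\<lambda>\<omega>. (x \<omega>)\<^sup>2) + expectation (\<lambda>\<omega>. \<bar>x \<omega>\<bar> powr R)))"
    by (simp add: algebra_simps)
  also have "\<dots> \<le> (\<Prod>k = 1..m. 1 + C * (expectation (\<lambda>\<omega>. (X k \<omega>)\<^sup>2) + expectation (\<lambda>\<omega>. \<bar>X k \<omega>\<bar> powr R))) *
    (1 + C * (expectation (\<lambda>\<omega>. (x \<omega>)\<^sup>2) + expectation (\<lambda>\<omega>. \<bar>x \<omega>\<bar> powr R)))"
    using C0 by (intro mult_right_mono IH2) auto
  finally show ?case using int unfolding \<phi>_def x_def S_def by simp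
qed

text \<open>The bound is uniform in the number of summands and in the weights. Each factor of the
  product is at most the exponential of a constant times \<open>(c k)^2\<close>, so only the sum of
  the squared weights, at most \<open>B\<close>, enters.\<close>

lemma (in prob_space) expectation_one_plus_square_powr_weighted_sum:
  fixes e :: "nat \<Rightarrow> 'a \<Rightarrow> real" and R v \<mu> B :: real
  assumes R: "R \<ge> 2" and indep: "indep_vars (\<lambda>_. borel) e {1..}"
    and int1: "\<And>k. k \<ge> 1 \<Longrightarrow> integrable M (e k)" and mean: "\<And>k. k \<ge> 1 \<Longrightarrow> expectation (e k) = 0"
    and int2: "\<And>k. k \<ge> 1 \<Longrightarrow> integrable M (\<lambda>\<omega>. (e k \<omega>)\<^sup>2)"
    and var: "\<And>k. k \<ge> 1 \<Longrightarrow> expectation (\<lambda>\<omega>. (e k \<omega>)\<^sup>2) \<le> v"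
    and intR: "\<And>k. k \<ge> 1 \<Longrightarrow> integrable M (\<lambda>\<omega>. \<bar>e k \<omega>\<bar> powr R)"
    and momR: "\<And>k. k \<ge> 1 \<Longrightarrow> expectation (\<lambda>\<omega>. \<bar>e k \<omega>\<bar> powr R) \<le> \<mu>"
  shows "\<exists>K. \<forall>m c. (\<Sum>k = 1..m. (c k)\<^sup>2) \<le> B \<longrightarrow>
    integrable M (\<lambda>\<omega>. (1 + (\<Sum>k = 1..m. c k * e k \<omega>)\<^sup>2) powr (R/2)) \<and>
    expectation (\<lambda>\<omega>. (1 + (\<Sum>k = 1..m. c k * e k \<omega>)\<^sup>2) powr (R/2)) \<le> K"
\<comment> \<open>The witness for \<open>K\<close> stays schematic and is fixed by the last
  \<open>show\<close>, where it appears with \<open>C\<close> written out.\<close>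
proof (intro exI allI impI)
  define C where "C = R * (R - 1) * 4 powr (R/2 - 1)"
  fix m and c :: "nat \<Rightarrow> real" assume cB: "(\<Sum>k = 1..m. (c k)\<^sup>2) \<le> B"
  have C0: "C \<ge> 0" unfolding C_def using R by simp
  have v0: "v \<ge> 0" by (rule order_trans[OF _ var[of 1]]) auto
  have \<mu>0: "\<mu> \<ge> 0" by (rule order_trans[OF _ momR[of 1]]) auto
  let ?D = "v + B powr (R/2 - 1) * \<mu>"
  have D0: "?D \<ge> 0" using v0 \<mu>0 by simp
  have indX: "indep_vars (\<lambda>_. borel) (\<lambda>k \<omega>. c k * e k \<omega>) {1..}"
    by (rule indep_vars_compose2[OF indep]) simp
  have 1: "integrable M (\<lambda>\<omega>. (1 + (\<Sum>k = 1..m. c k * e k \<omega>)\<^sup>2) powr (R/2)) \<and>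
    expectation (\<lambda>\<omega>. (1 + (\<Sum>k = 1..m. c k * e k \<omega>)\<^sup>2) powr (R/2)) \<le>
      (\<Prod>k = 1..m. 1 + C * (expectation (\<lambda>\<omega>. (c k * e k \<omega>)\<^sup>2) + expectation (\<lambda>\<omega>. \<bar>c k * e k \<omega>\<bar> powr R)))"
    unfolding C_def
    by (rule expectation_one_plus_square_powr_sum[OF R indX])
       (auto simp: int1 mean int2 intR power_mult_distrib abs_mult powr_mult)
  have "(\<Prod>k = 1..m. 1 + C * (expectation (\<lambda>\<omega>. (c k * e k \<omega>)\<^sup>2) + expectation (\<lambda>\<omega>. \<bar>c k * e k \<omega>\<bar> powr R)))
    \<le> (\<Prod>k = 1..m. exp (C * ?D * (c k)\<^sup>2))"
  proof (intro prod_mono conjI)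
    fix k assume k: "k \<in> {1..m}"
    show "0 \<le> 1 + C * (expectation (\<lambda>\<omega>. (c k * e k \<omega>)\<^sup>2) + expectation (\<lambda>\<omega>. \<bar>c k * e k \<omega>\<bar> powr R))"
      using C0 by (intro add_nonneg_nonneg mult_nonneg_nonneg) auto
    have "(c k)\<^sup>2 \<le> B"
      using member_le_sum[OF k, of "\<lambda>k. (c k)\<^sup>2"] cB by simp
    \<comment> \<open>As \<open>R\<close> is at least 2, two powers of the weight are kept and the
      remaining \<open>R - 2\<close> are bounded through \<open>(c k)^2 \<le> B\<close>.\<close>
    have cR: "\<bar>c k\<bar> powr R \<le> (c k)\<^sup>2 * B powr (R/2 - 1)"
    proof (cases "c k = 0")
      case False
      have "\<bar>c k\<bar> powr R = ((c k)\<^sup>2) powr (R/2)" by (rule abs_powr_square)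
      also have "\<dots> = (c k)\<^sup>2 * ((c k)\<^sup>2) powr (R/2 - 1)" using False by (simp add: powr_diff)
      also have "\<dots> \<le> (c k)\<^sup>2 * B powr (R/2 - 1)"
        using \<open>(c k)\<^sup>2 \<le> B\<close> R by (intro mult_left_mono powr_mono2) auto
      finally show ?thesis .
    qed simp
    have "expectation (\<lambda>\<omega>. (c k * e k \<omega>)\<^sup>2) \<le> (c k)\<^sup>2 * v"
      using k var[of k] by (simp add: power_mult_distrib mult_left_mono)
    moreover have "expectation (\<lambda>\<omega>. \<bar>c k * e k \<omega>\<bar> powr R) \<le> (c k)\<^sup>2 * B powr (R/2 - 1) * \<mu>"
      using k momR[of k] cR by (simp add: abs_mult powr_mult mult_mono)
    ultimately have "C * (expectation (\<lambda>\<omega>. (c k * e k \<omega>)\<^sup>2) + expectation (\<lambda>\<omega>. \<bar>c k * e k \<omega>\<bar> powr R))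
      \<le> C * ((c k)\<^sup>2 * v + (c k)\<^sup>2 * B powr (R/2 - 1) * \<mu>)" using C0 by (intro mult_left_mono add_mono) auto
    also have "\<dots> = C * ?D * (c k)\<^sup>2" by (simp add: algebra_simps)
    finally show "1 + C * (expectation (\<lambda>\<omega>. (c k * e k \<omega>)\<^sup>2) + expectation (\<lambda>\<omega>. \<bar>c k * e k \<omega>\<bar> powr R)) \<le> exp (C * ?D * (c k)\<^sup>2)"
      using exp_ge_add_one_self[of "C * ?D * (c k)\<^sup>2"] by linarith
  qed
  also have "\<dots> = exp (C * ?D * (\<Sum>k = 1..m. (c k)\<^sup>2))"
    by (simp add: exp_sum sum_distrib_left)
  also have "\<dots> \<le> exp (C * ?D * B)"
    using cB C0 D0 by (simp add: mult_left_mono)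
  finally show "integrable M (\<lambda>\<omega>. (1 + (\<Sum>k = 1..m. c k * e k \<omega>)\<^sup>2) powr (R/2)) \<and>
    expectation (\<lambda>\<omega>. (1 + (\<Sum>k = 1..m. c k * e k \<omega>)\<^sup>2) powr (R/2)) \<le>
      exp ((R * (R - 1) * 4 powr (R/2 - 1)) * (v + B powr (R/2 - 1) * \<mu>) * B)"
    using 1 unfolding C_def by linarith
qed

subsection \<open>Convergence of moments from characteristic functions\<close>

text \<open>Finite complex combinations of the characters \<open>iexp (t \<bullet> y)\<close>: the
  functions whose expectations are read off directly from the characteristic function.\<close>

inductive trig_poly :: "(real ^ 'k \<Rightarrow> complex) \<Rightarrow> bool" where
  iexp: "trig_poly (\<lambda>y. a * iexp (t \<bullet> y))"
| add: "trig_poly f \<Longrightarrow> trig_poly g \<Longrightarrow> trig_poly (\<lambda>y. f y + g y)"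

lemma trig_poly_mult:
  fixes f g :: "real ^ 'k::finite \<Rightarrow> complex"
  assumes "trig_poly f" "trig_poly g" shows "trig_poly (\<lambda>y. f y * g y)"
  using assms(1)
proof induction
  case (iexp a t)
  from assms(2) show ?case
  proof induction
    case (iexp b u)
    have "trig_poly (\<lambda>y. (a * b) * iexp ((t + u) \<bullet> y))" by (rule trig_poly.iexp)
    then show ?case by (simp add: inner_add_left exp_add algebra_simps)
  next
    case (add f g)
    from trig_poly.add[OF add.IH] show ?case by (simp add: algebra_simps)
  qed
next
  case (add f1 f2)
  from trig_poly.add[OF add.IH] show ?case by (simp add: algebra_simps)
qed

lemma trig_poly_sum:
  fixes f :: "'i \<Rightarrow> real ^ 'k::finite \<Rightarrow> complex"
  assumes "finite I" "\<And>i. i \<in> I \<Longrightarrow> trig_poly (f i)"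
  shows "trig_poly (\<lambda>y. \<Sum>i\<in>I. f i y)"
  using assms
proof (induction I)
  case empty
  then show ?case using trig_poly.iexp[of 0] by simp
next
  case (insert i I)
  then show ?case using trig_poly.add[of "f i" "\<lambda>y. \<Sum>i\<in>I. f i y"] by simp
qed

text \<open>A truncation to the cube of half-width \<open>L\<close> that tends to the identity as
  \<open>L\<close> grows. Unlike a hard cutoff, each coordinate is itself a trigonometric
  polynomial.\<close>

definition sin_wrap :: "real \<Rightarrow> real ^ 'k \<Rightarrow> real ^ 'k" where
  "sin_wrap L y = (\<chi> j. L * sin (y $ j / L))"

text \<open>Induction on the polynomial. A linear form is expanded in coordinates, each sine is a
  difference of two characters, and products of characters are again characters.\<close>

lemma trig_poly_polynomial_sin_wrap:
  assumes "real_polynomial_function (p :: real ^ 'k::finite \<Rightarrow> real)"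
  shows "trig_poly (\<lambda>y. of_real (p (sin_wrap L y)))"
  using assms
proof induction
  case (linear f)
  interpret bounded_linear f by fact
  have f: "f z = (\<Sum>j\<in>UNIV. z $ j * f (axis j 1))" for z
  proof -
    have "f z = f (\<Sum>j\<in>UNIV. z $ j *\<^sub>R axis j 1)"
      by (simp add: basis_expansion flip: scalar_mult_eq_scaleR)
    then show ?thesis by (simp add: sum scaleR)
  qed
  have "trig_poly (\<lambda>y. of_real (sin_wrap L y $ j * f (axis j 1)))" for j
  proof -
    \<comment> \<open>The coefficient comes from
      \<open>sin u = (exp (i u) - exp (- i u)) / (2 i)\<close> at \<open>u = y $ j / L\<close>, with
      the scale \<open>L\<close> and the coefficient of the linear form absorbed.\<close>
    let ?a = "complex_of_real (L * f (axis j 1)) / (2 * \<i>)"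
    have "trig_poly (\<lambda>y. ?a * iexp (axis j (1/L) \<bullet> y) + (- ?a) * iexp (axis j (- (1/L)) \<bullet> y))"
      by (intro trig_poly.add trig_poly.iexp)
    moreover have "?a * iexp (axis j (1/L) \<bullet> y) + (- ?a) * iexp (axis j (- (1/L)) \<bullet> y) =
      of_real (sin_wrap L y $ j * f (axis j 1))" for y
      by (simp add: sin_wrap_def inner_axis' sin_of_real[symmetric] sin_exp_eq' sin_exp_eq field_simps del: sin_of_real)
    ultimately show ?thesis by simp
  qed
  then have "trig_poly (\<lambda>y. \<Sum>j\<in>UNIV. of_real (sin_wrap L y $ j * f (axis j 1)))"
    by (intro trig_poly_sum) auto
  then show ?case by (subst f) simp
next
  case (const c)
  then show ?case using trig_poly.iexp[of "of_real c" 0] by simp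
next
  case (add f g)
  then show ?case using trig_poly.add by fastforce
next
  case (mult f g)
  then show ?case using trig_poly_mult by fastforce
qed

text \<open>Linearity of the integral extends the convergence from single characters to their sums.
  Integrability is part of the claim because the addition step uses it.\<close>

lemma trig_poly_expectation:
  fixes X :: "nat \<Rightarrow> 'a \<Rightarrow> real ^ 'k::finite" and Y :: "'b \<Rightarrow> real ^ 'k"
  assumes M: "prob_space M" and N: "prob_space N"
    and X[measurable]: "\<And>n. X n \<in> borel_measurable M" and Y[measurable]: "Y \<in> borel_measurable N"
    and cf: "\<And>t. (\<lambda>n. CLINT \<omega>|M. iexp (t \<bullet> X n \<omega>)) \<longlonglongrightarrow> (CLINT \<omega>|N. iexp (t \<bullet> Y \<omega>))"
    and f: "trig_poly f"
  shows "(\<forall>n. integrable M (\<lambda>\<omega>. f (X n \<omega>))) \<and> integrable N (\<lambda>\<omega>. f (Y \<omega>)) \<and>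
    (\<lambda>n. CLINT \<omega>|M. f (X n \<omega>)) \<longlonglongrightarrow> (CLINT \<omega>|N. f (Y \<omega>))"
  using f
proof induction
  case (iexp a t)
  interpret M: prob_space M by fact
  interpret N: prob_space N by fact
  have "integrable M (\<lambda>\<omega>. a * iexp (t \<bullet> X n \<omega>))" for n
    by (intro integrable_mult_right M.integrable_const_bound[of _ 1]) auto
  moreover have "integrable N (\<lambda>\<omega>. a * iexp (t \<bullet> Y \<omega>))"
    by (intro integrable_mult_right N.integrable_const_bound[of _ 1]) auto
  ultimately show ?case using tendsto_mult_left[OF cf] by auto
next
  case (add f g)
  then show ?case by (auto intro: tendsto_add)
qed

section \<open>Elementary estimates for the sine truncation\<close>

lemma norm_sin_wrap_le:
  assumes "L > 0" shows "norm (sin_wrap L y) \<le> norm (y :: real ^ 'k::finite)"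
proof (rule norm_le_componentwise_cart)
  fix j
  have "L * \<bar>sin (y $ j / L)\<bar> \<le> L * \<bar>y $ j / L\<bar>"
    using assms by (intro mult_left_mono abs_sin_x_le_abs_x) auto
  then show "norm (sin_wrap L y $ j) \<le> norm (y $ j)"
    using assms by (simp add: sin_wrap_def abs_mult)
qed

lemma sin_wrap_in_cbox: "L > 0 \<Longrightarrow> sin_wrap L y \<in> cbox (\<chi> j. -L) (\<chi> j. L)"
  unfolding mem_box_cart sin_wrap_def
proof (intro allI conjI)
  fix j assume L: "L > 0"
  have "L * sin (y $ j / L) \<le> L * 1" "L * (-1) \<le> L * sin (y $ j / L)" using L by (intro mult_left_mono; simp)+
  then show "(\<chi> j. - L) $ j \<le> (\<chi> j. L * sin (y $ j / L)) $ j" "(\<chi> j. L * sin (y $ j / L)) $ j \<le> (\<chi> j. L) $ j" by auto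
qed

lemma continuous_sin_wrap: "continuous_on UNIV (sin_wrap L :: real ^ 'k::finite \<Rightarrow> _)"
  unfolding sin_wrap_def divide_inverse by (intro continuous_on_vec_lambda continuous_intros)

lemma tendsto_sin_wrap: "(\<lambda>m. sin_wrap (real m) y) \<longlonglongrightarrow> (y :: real ^ 'k::finite)"
proof (rule vec_tendstoI)
  fix j
  have "(\<lambda>m. real m * sin (y $ j / real m)) \<longlonglongrightarrow> y $ j" by real_asymp
  then show "(\<lambda>m. sin_wrap (real m) y $ j) \<longlonglongrightarrow> y $ j" by (simp add: sin_wrap_def)
qed

text \<open>The second-order error of the sine in each coordinate, rescaled by \<open>L\<close>, is
  at most \<open>(norm y)^2 / L\<close>; comparison with the sum of the coordinates gives the
  dimension factor. The truncation error is therefore uniformly small on balls for large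
  \<open>L\<close>.\<close>

lemma sin_wrap_close:
  fixes y :: "real ^ 'k::finite"
  assumes "L > 0" shows "norm (y - sin_wrap L y) \<le> real CARD('k) * ((norm y)\<^sup>2 / L)"
proof -
  have "norm (y - sin_wrap L y) \<le> (\<Sum>j\<in>UNIV. \<bar>(y - sin_wrap L y) $ j\<bar>)" by (rule norm_le_l1_cart)
  also have "\<dots> \<le> (\<Sum>j\<in>(UNIV::'k set). (norm y)\<^sup>2 / L)"
  proof (rule sum_mono)
    fix j
    let ?u = "y $ j / L"
    have "\<bar>sin ?u - ?u\<bar> \<le> ?u\<^sup>2 / 2"
      using Maclaurin_sin_bound[of ?u 2] by (simp add: eval_nat_numeral sin_coeff_def)
    then have "\<bar>?u - sin ?u\<bar> \<le> ?u\<^sup>2" using zero_le_power2[of ?u] by linarith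
    then have "L * \<bar>?u - sin ?u\<bar> \<le> L * ?u\<^sup>2" using assms by (intro mult_left_mono) auto
    also have "L * ?u\<^sup>2 = \<bar>y $ j\<bar>\<^sup>2 / L" using assms by (simp add: power2_eq_square)
    also have "\<dots> \<le> (norm y)\<^sup>2 / L" using assms by (intro divide_right_mono power_mono component_le_norm_cart) auto
    also have "L * \<bar>?u - sin ?u\<bar> = \<bar>(y - sin_wrap L y) $ j\<bar>" using assms
      by (simp add: sin_wrap_def abs_mult_pos' right_diff_distrib)
    finally show "\<bar>(y - sin_wrap L y) $ j\<bar> \<le> (norm y)\<^sup>2 / L" .
  qed
  finally show ?thesis by simp
qed

text \<open>By Stone-Weierstrass, \<open>f\<close> is uniformly within \<open>e/3\<close> of a
  polynomial on the compact cube. Composed with the truncation that polynomial is a trigonometric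
  polynomial, so its expectations converge, and the approximation costs at most \<open>e/3\<close>
  on either side. No growth bound on \<open>f\<close> enters, since \<open>f\<close> is bounded on
  the cube.\<close>

lemma sin_wrap_expectation:
  fixes X :: "nat \<Rightarrow> 'a \<Rightarrow> real ^ 'k::finite" and Y :: "'b \<Rightarrow> real ^ 'k" and f :: "real ^ 'k \<Rightarrow> real"
  assumes M: "prob_space M" and N: "prob_space N"
    and X[measurable]: "\<And>n. X n \<in> borel_measurable M" and Y[measurable]: "Y \<in> borel_measurable N"
    and cf: "\<And>t. (\<lambda>n. CLINT \<omega>|M. iexp (t \<bullet> X n \<omega>)) \<longlonglongrightarrow> (CLINT \<omega>|N. iexp (t \<bullet> Y \<omega>))"
    and f: "continuous_on UNIV f" and L: "L > 0"
  shows "(\<forall>n. integrable M (\<lambda>\<omega>. f (sin_wrap L (X n \<omega>)))) \<and> integrable N (\<lambda>\<omega>. f (sin_wrap L (Y \<omega>))) \<and>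
    (\<lambda>n. LINT \<omega>|M. f (sin_wrap L (X n \<omega>))) \<longlonglongrightarrow> (LINT \<omega>|N. f (sin_wrap L (Y \<omega>)))"
proof -
  interpret M: prob_space M by fact
  interpret N: prob_space N by fact
  let ?B = "cbox (\<chi> j. -L) (\<chi> j. L) :: (real ^ 'k) set"
  have fB: "continuous_on ?B f" using f continuous_on_subset by blast
  have "bounded (f ` ?B)" using compact_continuous_image[OF fB compact_cbox] compact_imp_bounded by blast
  then obtain b where b: "\<And>z. z \<in> ?B \<Longrightarrow> \<bar>f z\<bar> \<le> b" unfolding bounded_iff by auto
  have [measurable]: "(\<lambda>y. f (sin_wrap L y)) \<in> borel_measurable borel"
    by (intro borel_measurable_continuous_onI continuous_on_compose2[OF f continuous_sin_wrap]) auto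
  have iM: "integrable M (\<lambda>\<omega>. f (sin_wrap L (X n \<omega>)))" for n
    by (rule M.integrable_const_bound[of _ b]) (auto intro!: b sin_wrap_in_cbox L)
  have iN: "integrable N (\<lambda>\<omega>. f (sin_wrap L (Y \<omega>)))"
    by (rule N.integrable_const_bound[of _ b]) (auto intro!: b sin_wrap_in_cbox L)
  have "(\<lambda>n. LINT \<omega>|M. f (sin_wrap L (X n \<omega>))) \<longlonglongrightarrow> (LINT \<omega>|N. f (sin_wrap L (Y \<omega>)))"
  proof (rule LIMSEQ_I)
    fix e :: real assume e: "e > 0"
    obtain p where p: "real_polynomial_function p" and pf: "\<And>z. z \<in> ?B \<Longrightarrow> \<bar>f z - p z\<bar> < e/3"
      using Stone_Weierstrass_real_polynomial_function[OF compact_cbox fB, of "e/3"] e by auto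
    let ?q = "\<lambda>y. p (sin_wrap L y)"
    have pf': "\<bar>f (sin_wrap L y) - ?q y\<bar> \<le> e/3" for y
      by (intro less_imp_le pf sin_wrap_in_cbox L)
    note t = trig_poly_expectation[OF M N X Y cf trig_poly_polynomial_sin_wrap[OF p, of L]]
    have qM: "integrable M (\<lambda>\<omega>. ?q (X n \<omega>))" for n using t by (simp add: complex_of_real_integrable_eq)
    have qN: "integrable N (\<lambda>\<omega>. ?q (Y \<omega>))" using t by (simp add: complex_of_real_integrable_eq)
    have "(\<lambda>n. complex_of_real (LINT \<omega>|M. ?q (X n \<omega>))) \<longlonglongrightarrow> complex_of_real (LINT \<omega>|N. ?q (Y \<omega>))"
      using t by simp
    then have "(\<lambda>n. LINT \<omega>|M. ?q (X n \<omega>)) \<longlonglongrightarrow> (LINT \<omega>|N. ?q (Y \<omega>))"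
      by (simp only: tendsto_of_real_iff)
    from LIMSEQ_D[OF this, of "e/3"] e obtain n0 where n0:
      "\<And>n. n \<ge> n0 \<Longrightarrow> \<bar>(LINT \<omega>|M. ?q (X n \<omega>)) - (LINT \<omega>|N. ?q (Y \<omega>))\<bar> < e/3" by auto
    have dM: "\<bar>(LINT \<omega>|M. f (sin_wrap L (X n \<omega>))) - (LINT \<omega>|M. ?q (X n \<omega>))\<bar> \<le> e/3" for n
    proof -
      have "\<bar>LINT \<omega>|M. f (sin_wrap L (X n \<omega>)) - ?q (X n \<omega>)\<bar> \<le> (LINT \<omega>|M. \<bar>f (sin_wrap L (X n \<omega>)) - ?q (X n \<omega>)\<bar>)"
        by (rule integral_abs_bound)
      also have "\<dots> \<le> (LINT \<omega>|M. e/3)"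
        using iM[of n] qM[of n] by (intro integral_mono pf') auto
      finally show ?thesis using iM[of n] qM[of n] by (simp add: M.prob_space)
    qed
    have dN: "\<bar>(LINT \<omega>|N. f (sin_wrap L (Y \<omega>))) - (LINT \<omega>|N. ?q (Y \<omega>))\<bar> \<le> e/3"
    proof -
      have "\<bar>LINT \<omega>|N. f (sin_wrap L (Y \<omega>)) - ?q (Y \<omega>)\<bar> \<le> (LINT \<omega>|N. \<bar>f (sin_wrap L (Y \<omega>)) - ?q (Y \<omega>)\<bar>)"
        by (rule integral_abs_bound)
      also have "\<dots> \<le> (LINT \<omega>|N. e/3)"
        using iN qN by (intro integral_mono pf') auto
      finally show ?thesis using iN qN by (simp add: N.prob_space)
    qed
    show "\<exists>no. \<forall>n\<ge>no. norm ((LINT \<omega>|M. f (sin_wrap L (X n \<omega>))) - (LINT \<omega>|N. f (sin_wrap L (Y \<omega>)))) < e"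
    proof (intro exI allI impI)
      fix n assume "n \<ge> n0"
      from n0[OF this] dM[of n] dN show "norm ((LINT \<omega>|M. f (sin_wrap L (X n \<omega>))) - (LINT \<omega>|N. f (sin_wrap L (Y \<omega>)))) < e"
        unfolding real_norm_def by linarith
    qed
  qed
  with iM iN show ?thesis by blast
qed

text \<open>Makes growth of order \<open>s\<close> negligible against an \<open>R\<close>-th moment
  outside a large ball; this serves both the truncation error and uniform integrability.\<close>

lemma powr_dominated:
  fixes s R :: real
  assumes "s < R" "d > 0"
  shows "\<exists>K\<ge>0. \<forall>u\<ge>K. (1 + u) powr s \<le> d * (1 + u) powr R"
proof -
  have "((\<lambda>u::real. (1 + u) powr (s - R)) \<longlongrightarrow> 0) at_top" using assms by real_asymp
  then have "\<forall>\<^sub>F u in at_top. (1 + u) powr (s - R) < d" using assms by (intro order_tendstoD) auto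
  then obtain K where K: "\<And>u::real. u \<ge> K \<Longrightarrow> (1 + u) powr (s - R) < d"
    unfolding eventually_at_top_linorder by auto
  have "(1 + u) powr s \<le> d * (1 + u) powr R" if "u \<ge> max K 0" for u
  proof -
    have "(1 + u) powr s = (1 + u) powr (s - R) * (1 + u) powr R" by (simp flip: powr_add)
    also have "\<dots> \<le> d * (1 + u) powr R" using K[of u] that by (intro mult_right_mono) auto
    finally show ?thesis .
  qed
  then show ?thesis by (intro exI[of _ "max K 0"]) auto
qed

text \<open>Truncation changes \<open>f\<close> by at most a small multiple of
  \<open>(1 + norm y) powr R\<close>, whose expectation is bounded by \<open>B\<close> along the
  sequence and in the limit. The expectations of the truncated function converge, so a three-term
  estimate finishes.\<close>

lemma moment_convergence:
  fixes X :: "nat \<Rightarrow> 'a \<Rightarrow> real ^ 'k::finite" and Y :: "'b \<Rightarrow> real ^ 'k" and f :: "real ^ 'k \<Rightarrow> real"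
  assumes M: "prob_space M" and N: "prob_space N"
    and X[measurable]: "\<And>n. X n \<in> borel_measurable M" and Y[measurable]: "Y \<in> borel_measurable N"
    and cf: "\<And>t. (\<lambda>n. CLINT \<omega>|M. iexp (t \<bullet> X n \<omega>)) \<longlonglongrightarrow> (CLINT \<omega>|N. iexp (t \<bullet> Y \<omega>))"
    and intX: "\<And>n. integrable M (\<lambda>\<omega>. (1 + norm (X n \<omega>)) powr R)"
    and boundX: "\<And>n. (LINT \<omega>|M. (1 + norm (X n \<omega>)) powr R) \<le> B"
    and f: "continuous_on UNIV f" and fs: "\<And>y. \<bar>f y\<bar> \<le> (1 + norm y) powr s"
    and s: "0 \<le> s" "s < R"
  shows "(\<lambda>n. LINT \<omega>|M. f (X n \<omega>)) \<longlonglongrightarrow> (LINT \<omega>|N. f (Y \<omega>))"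
proof -
  interpret M: prob_space M by fact
  interpret N: prob_space N by fact
  define G where "G y = (1 + norm y) powr R" for y :: "real ^ 'k"
  have G1: "G y \<ge> 1" for y unfolding G_def using s by (simp add: ge_one_powr_ge_zero)
  have Gcont: "continuous_on UNIV G" unfolding G_def
    by (intro continuous_intros) (auto simp: add_nonneg_eq_0_iff)
  have Gwrap: "G (sin_wrap L y) \<le> G y" if "L > 0" for L y
    unfolding G_def using norm_sin_wrap_le[OF that, of y] s by (intro powr_mono2) auto
  have [measurable]: "G \<in> borel_measurable borel" "f \<in> borel_measurable borel"
    using Gcont f by (auto intro: borel_measurable_continuous_onI)
  have intGX: "integrable M (\<lambda>\<omega>. G (X n \<omega>))" and EGX: "(LINT \<omega>|M. G (X n \<omega>)) \<le> B" for n
    using intX boundX unfolding G_def by auto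
  have B1: "B \<ge> 1"
    using integral_mono[OF _ intGX[of 0], of "\<lambda>_. 1"] G1 EGX[of 0] by (simp add: M.prob_space)
  \<comment> \<open>The limit law inherits the moment bound for the truncated weight: truncation
    does not increase \<open>G\<close>, and the truncated expectations converge.\<close>
  have EGL: "(LINT \<omega>|N. G (sin_wrap L (Y \<omega>))) \<le> B" and iGL: "integrable N (\<lambda>\<omega>. G (sin_wrap L (Y \<omega>)))"
    if L: "L > 0" for L
  proof -
    note * = sin_wrap_expectation[OF M N X Y cf Gcont L]
    then show "integrable N (\<lambda>\<omega>. G (sin_wrap L (Y \<omega>)))" by blast
    show "(LINT \<omega>|N. G (sin_wrap L (Y \<omega>))) \<le> B"
    proof (rule LIMSEQ_le_const2)
      show "(\<lambda>n. LINT \<omega>|M. G (sin_wrap L (X n \<omega>))) \<longlonglongrightarrow> (LINT \<omega>|N. G (sin_wrap L (Y \<omega>)))" using * by blast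
      show "\<exists>N. \<forall>n\<ge>N. (LINT \<omega>|M. G (sin_wrap L (X n \<omega>))) \<le> B"
      proof (intro exI allI impI)
        fix n
        have "(LINT \<omega>|M. G (sin_wrap L (X n \<omega>))) \<le> (LINT \<omega>|M. G (X n \<omega>))"
          using * Gwrap[OF L] by (intro integral_mono intGX) auto
        with EGX[of n] show "(LINT \<omega>|M. G (sin_wrap L (X n \<omega>))) \<le> B" by linarith
      qed
    qed
  qed
  have lim: "(\<lambda>m. G (sin_wrap (real (Suc m)) y)) \<longlonglongrightarrow> G y" for y
  proof (rule isCont_tendsto_compose[of _ G])
    show "isCont G y" using Gcont continuous_on_eq_continuous_at[OF open_UNIV] by blast
    show "(\<lambda>m. sin_wrap (real (Suc m)) y) \<longlonglongrightarrow> y" using LIMSEQ_Suc[OF tendsto_sin_wrap] .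
  qed
  \<comment> \<open>Fatou's lemma removes the truncation as its level tends to infinity. The levels
    are \<open>Suc m\<close> because the bounds above require a positive level.\<close>
  have "(\<integral>\<^sup>+ \<omega>. ennreal (G (Y \<omega>)) \<partial>N) = (\<integral>\<^sup>+ \<omega>. liminf (\<lambda>m. ennreal (G (sin_wrap (real (Suc m)) (Y \<omega>)))) \<partial>N)"
    by (intro nn_integral_cong lim_imp_Liminf[symmetric] tendsto_ennrealI lim) simp
  also have "\<dots> \<le> liminf (\<lambda>m. \<integral>\<^sup>+ \<omega>. ennreal (G (sin_wrap (real (Suc m)) (Y \<omega>))) \<partial>N)"
    by (intro nn_integral_liminf measurable_compose[OF borel_measurable_integrable[OF iGL]]) auto
  also have "\<dots> \<le> liminf (\<lambda>m. ennreal B)"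
  proof (intro Liminf_mono always_eventually allI)
    fix m
    have "(\<integral>\<^sup>+ \<omega>. ennreal (G (sin_wrap (real (Suc m)) (Y \<omega>))) \<partial>N) = ennreal (LINT \<omega>|N. G (sin_wrap (real (Suc m)) (Y \<omega>)))"
      using G1 by (intro nn_integral_eq_integral iGL) (auto intro: order_trans[OF zero_le_one])
    also have "\<dots> \<le> ennreal B" by (intro ennreal_leI EGL) simp
    finally show "(\<integral>\<^sup>+ \<omega>. ennreal (G (sin_wrap (real (Suc m)) (Y \<omega>))) \<partial>N) \<le> ennreal B" .
  qed
  finally have nnG: "(\<integral>\<^sup>+ \<omega>. ennreal (G (Y \<omega>)) \<partial>N) \<le> ennreal B" by (simp add: Liminf_const)
  have G0: "0 \<le> G y" for y using G1[of y] by linarith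
  have intGY: "integrable N (\<lambda>\<omega>. G (Y \<omega>))"
    by (rule integrableI_bounded) (use nnG G0 in \<open>auto simp: le_less_trans\<close>)
  have EGY: "(LINT \<omega>|N. G (Y \<omega>)) \<le> B"
    using nnG B1 by (subst (asm) nn_integral_eq_integral[OF intGY]) (auto simp: G0)
  have fG: "\<bar>f y\<bar> \<le> G y" for y
    using order_trans[OF fs[of y] powr_mono[of s R "1 + norm y"]] s unfolding G_def by simp
  have intfX: "integrable M (\<lambda>\<omega>. f (X n \<omega>))" for n
    by (rule Bochner_Integration.integrable_bound[OF intGX[of n]]) (use fG G0 in auto)
  have intfY: "integrable N (\<lambda>\<omega>. f (Y \<omega>))"
    by (rule Bochner_Integration.integrable_bound[OF intGY]) (use fG G0 in auto)
  \<comment> \<open>Inside the ball of radius \<open>K\<close>, uniform continuity and closeness of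
    the truncation give the bound; outside, both values of \<open>f\<close> are small compared with
    \<open>G\<close>, each taking a share \<open>d / 2\<close>.\<close>
  have approx: "\<exists>L>0. \<forall>y. \<bar>f y - f (sin_wrap L y)\<bar> \<le> d * G y" if d: "d > 0" for d
  proof -
    obtain K where "K \<ge> 0" and K': "\<And>u. u \<ge> K \<Longrightarrow> (1 + u) powr s \<le> d / 2 * (1 + u) powr R"
      using powr_dominated[OF s(2), of "d / 2"] d by auto
    have K: "(1 + norm y) powr s \<le> d / 2 * G y" if "norm y \<ge> K" for y :: "real ^ 'k"
      using K'[OF that] unfolding G_def .
    have "uniformly_continuous_on (cball 0 K) f"
      using f by (intro compact_uniformly_continuous compact_cball) (rule continuous_on_subset, auto)
    then obtain \<delta> where \<delta>: "\<delta> > 0" "\<And>y z. y \<in> cball 0 K \<Longrightarrow> z \<in> cball 0 K \<Longrightarrow> dist z y < \<delta> \<Longrightarrow> dist (f z) (f y) < d"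
      using d unfolding uniformly_continuous_on_def by metis
    \<comment> \<open>Large enough that the truncation moves points of the ball by less than
      \<open>\<delta>\<close>; the summand 1 makes that strict and keeps \<open>L\<close> positive
      when \<open>K = 0\<close>.\<close>
    define L where "L = real CARD('k) * K\<^sup>2 / \<delta> + 1"
    have L: "L > 0" unfolding L_def using \<delta>(1) by (intro add_nonneg_pos) auto
    have "\<bar>f y - f (sin_wrap L y)\<bar> \<le> d * G y" for y
    proof (cases "norm y \<le> K")
      case True
      have "dist (sin_wrap L y) y \<le> real CARD('k) * ((norm y)\<^sup>2 / L)"
        using sin_wrap_close[OF L, of y] by (simp add: dist_norm norm_minus_commute)
      also have "\<dots> \<le> real CARD('k) * (K\<^sup>2 / L)"
        using True L by (intro mult_left_mono divide_right_mono power_mono) auto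
      also have "\<dots> < \<delta>" using L \<delta>(1) unfolding L_def by (simp add: field_simps)
      finally have "dist (f (sin_wrap L y)) (f y) < d"
        using True norm_sin_wrap_le[OF L, of y] by (intro \<delta>(2)) auto
      then have "\<bar>f y - f (sin_wrap L y)\<bar> \<le> d * 1" by (simp add: dist_real_def abs_minus_commute)
      also have "\<dots> \<le> d * G y" using d G1 by (intro mult_left_mono) auto
      finally show ?thesis .
    next
      case False
      have "\<bar>f (sin_wrap L y)\<bar> \<le> (1 + norm (sin_wrap L y)) powr s" by (rule fs)
      also have "\<dots> \<le> (1 + norm y) powr s" using norm_sin_wrap_le[OF L, of y] s by (intro powr_mono2) auto
      finally show ?thesis using fs[of y] K[of y] False by simp
    qed
    with L show ?thesis by blast
  qed
  show ?thesis
  proof (rule LIMSEQ_I)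
    fix e :: real assume e: "e > 0"
    define d where "d = e / (3 * B)"
    have d: "d > 0" unfolding d_def using e B1 by simp
    have dB: "d * B = e / 3" unfolding d_def using B1 by simp
    from approx[OF d] obtain L where L: "L > 0" and fL: "\<And>y. \<bar>f y - f (sin_wrap L y)\<bar> \<le> d * G y" by blast
    note * = sin_wrap_expectation[OF M N X Y cf f L]
    have dM: "\<bar>(LINT \<omega>|M. f (X n \<omega>)) - (LINT \<omega>|M. f (sin_wrap L (X n \<omega>)))\<bar> \<le> e / 3" for n
    proof -
      have "\<bar>LINT \<omega>|M. f (X n \<omega>) - f (sin_wrap L (X n \<omega>))\<bar> \<le> (LINT \<omega>|M. \<bar>f (X n \<omega>) - f (sin_wrap L (X n \<omega>))\<bar>)"
        by (rule integral_abs_bound)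
      also have "\<dots> \<le> (LINT \<omega>|M. d * G (X n \<omega>))"
        using * intfX[of n] by (intro integral_mono fL integrable_mult_right intGX) auto
      also have "\<dots> \<le> d * B" using EGX[of n] d by simp
      finally show ?thesis using * intfX[of n] dB by simp
    qed
    have dN: "\<bar>(LINT \<omega>|N. f (Y \<omega>)) - (LINT \<omega>|N. f (sin_wrap L (Y \<omega>)))\<bar> \<le> e / 3"
    proof -
      have "\<bar>LINT \<omega>|N. f (Y \<omega>) - f (sin_wrap L (Y \<omega>))\<bar> \<le> (LINT \<omega>|N. \<bar>f (Y \<omega>) - f (sin_wrap L (Y \<omega>))\<bar>)"
        by (rule integral_abs_bound)
      also have "\<dots> \<le> (LINT \<omega>|N. d * G (Y \<omega>))"
        using * intfY by (intro integral_mono fL integrable_mult_right intGY) auto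
      also have "\<dots> \<le> d * B" using EGY d by simp
      finally show ?thesis using * intfY dB by simp
    qed
    have "(\<lambda>n. LINT \<omega>|M. f (sin_wrap L (X n \<omega>))) \<longlonglongrightarrow> (LINT \<omega>|N. f (sin_wrap L (Y \<omega>)))" using * by blast
    from LIMSEQ_D[OF this, of "e/3"] e obtain n0 where n0: "\<And>n. n \<ge> n0 \<Longrightarrow>
      \<bar>(LINT \<omega>|M. f (sin_wrap L (X n \<omega>))) - (LINT \<omega>|N. f (sin_wrap L (Y \<omega>)))\<bar> < e/3" by auto
    show "\<exists>no. \<forall>n\<ge>no. norm ((LINT \<omega>|M. f (X n \<omega>)) - (LINT \<omega>|N. f (Y \<omega>))) < e"
    proof (intro exI allI impI)
      fix n assume "n \<ge> n0"
      from n0[OF this] dM[of n] dN show "norm ((LINT \<omega>|M. f (X n \<omega>)) - (LINT \<omega>|N. f (Y \<omega>))) < e"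
        unfolding real_norm_def by linarith
    qed
  qed
qed

subsection \<open>Lindeberg central limit theorem for characteristic functions\<close>

text \<open>One cutoff \<open>c\<close> serves all errors at once, and the tail integrals against
  the distribution functions become real-valued integrals on the sample space.\<close>

lemma tails_negligibleD:
  assumes "tails_negligible M e" and "\<eta> > 0"
    and meas: "\<And>k. k \<ge> 1 \<Longrightarrow> e k \<in> borel_measurable M"
    and int2: "\<And>k. k \<ge> 1 \<Longrightarrow> integrable M (\<lambda>\<omega>. (e k \<omega>)\<^sup>2)"
  shows "\<exists>c>0. \<forall>k\<ge>1. (LINT \<omega>|M. (e k \<omega>)\<^sup>2 * indicator {\<omega>. \<bar>e k \<omega>\<bar> > c} \<omega>) \<le> \<eta>"
proof -
  have "\<forall>\<^sub>F c in at_top. (SUP i\<in>{1..}. \<integral>\<^sup>+ u. ennreal (u\<^sup>2) * indicator {u. \<bar>u\<bar> > c} u \<partial>distr M borel (e i)) < ennreal \<eta>"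
    using assms(1,2) unfolding tails_negligible_def by (intro order_tendstoD) auto
  then have "\<forall>\<^sub>F c in at_top. c > 0 \<and> (SUP i\<in>{1..}. \<integral>\<^sup>+ u. ennreal (u\<^sup>2) * indicator {u. \<bar>u\<bar> > c} u \<partial>distr M borel (e i)) < ennreal \<eta>"
    using eventually_gt_at_top[of "0::real"] by eventually_elim simp
  then obtain c :: real where c: "c > 0"
    and sup: "(SUP i\<in>{1..}. \<integral>\<^sup>+ u. ennreal (u\<^sup>2) * indicator {u. \<bar>u\<bar> > c} u \<partial>distr M borel (e i)) < ennreal \<eta>"
    by (auto dest!: eventually_happens)
  have "(LINT \<omega>|M. (e k \<omega>)\<^sup>2 * indicator {\<omega>. \<bar>e k \<omega>\<bar> > c} \<omega>) \<le> \<eta>" if k: "k \<ge> 1" for k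
  proof -
    note [measurable] = meas[OF k]
    have "ennreal (LINT \<omega>|M. (e k \<omega>)\<^sup>2 * indicator {\<omega>. \<bar>e k \<omega>\<bar> > c} \<omega>) =
      (\<integral>\<^sup>+ \<omega>. ennreal ((e k \<omega>)\<^sup>2 * indicator {\<omega>. \<bar>e k \<omega>\<bar> > c} \<omega>) \<partial>M)"
      by (intro nn_integral_eq_integral[symmetric] Bochner_Integration.integrable_bound[OF int2[OF k]])
         (auto simp: indicator_def)
    also have "\<dots> = (\<integral>\<^sup>+ u. ennreal (u\<^sup>2) * indicator {u. \<bar>u\<bar> > c} u \<partial>distr M borel (e k))"
      by (subst nn_integral_distr) (auto intro!: nn_integral_cong simp: indicator_def)
    also have "\<dots> \<le> (SUP i\<in>{1..}. \<integral>\<^sup>+ u. ennreal (u\<^sup>2) * indicator {u. \<bar>u\<bar> > c} u \<partial>distr M borel (e i))"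
      using k by (intro SUP_upper) auto
    also have "\<dots> \<le> ennreal \<eta>" using sup by simp
    finally show ?thesis using assms(2) by (simp add: ennreal_le_iff)
  qed
  with c show ?thesis by blast
qed

text \<open>Both sides come from \<open>1 + v \<le> exp v\<close>: at \<open>v = - u\<close> for the
  lower estimate, and at \<open>v = u\<close>, inverted, for
  \<open>exp (- u) \<le> 1 / (1 + u) \<le> 1 - u + u^2\<close>.\<close>

lemma abs_exp_minus_bound:
  fixes u :: real assumes "u \<ge> 0" shows "\<bar>(1 - u) - exp (- u)\<bar> \<le> u\<^sup>2"
proof -
  have "1 + u \<le> exp u" by (rule exp_ge_add_one_self)
  then have "exp (- u) \<le> 1 / (1 + u)" using assms by (simp add: exp_minus field_simps)
  also have "\<dots> \<le> 1 - u + u\<^sup>2"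
    using assms by (simp add: field_simps power2_eq_square)
  finally show ?thesis using exp_ge_add_one_self[of "- u"] by auto
qed

text \<open>The characteristic function of the sum factors by independence. Each factor is compared
  with a Gaussian factor of the same variance, and as all factors have modulus at most 1, the
  products differ by at most the sum of the individual errors. Uniformly small tails of the errors
  and uniformly small weights make that sum vanish.\<close>

lemma (in prob_space) lindeberg_char:
  fixes e :: "nat \<Rightarrow> 'a \<Rightarrow> real" and d :: "nat \<Rightarrow> nat \<Rightarrow> real"
  assumes indep: "indep_vars (\<lambda>_. borel) e {1..}"
    and int1: "\<And>k. k \<ge> 1 \<Longrightarrow> integrable M (e k)" and mean: "\<And>k. k \<ge> 1 \<Longrightarrow> expectation (e k) = 0"
    and int2: "\<And>k. k \<ge> 1 \<Longrightarrow> integrable M (\<lambda>\<omega>. (e k \<omega>)\<^sup>2)"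
    and var: "\<And>k. k \<ge> 1 \<Longrightarrow> variance (e k) = \<sigma>\<^sup>2"
    and tails: "tails_negligible M e"
    and sq: "(\<lambda>n. \<Sum>k = 1..n. (d n k)\<^sup>2) \<longlonglongrightarrow> w"
    and small: "\<And>\<delta>. \<delta> > 0 \<Longrightarrow> \<forall>\<^sub>F n in sequentially. \<forall>k\<in>{1..n}. \<bar>d n k\<bar> \<le> \<delta>"
  shows "(\<lambda>n. CLINT \<omega>|M. iexp (\<Sum>k = 1..n. d n k * e k \<omega>)) \<longlonglongrightarrow> complex_of_real (exp (- (\<sigma>\<^sup>2 * w) / 2))"
proof -
  have rv[measurable]: "e k \<in> borel_measurable M" if "k \<ge> 1" for k
    using int1[OF that] by (rule borel_measurable_integrable)
  define z where "z n k = char (distr M borel (e k)) (d n k)" for n k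
  define g where "g n k = complex_of_real (exp (- (\<sigma>\<^sup>2 * (d n k)\<^sup>2 / 2)))" for n k
  have second: "expectation (\<lambda>\<omega>. (e k \<omega>)\<^sup>2) = \<sigma>\<^sup>2" if "k \<ge> 1" for k
    using var[OF that] mean[OF that] by simp
  have prod_z: "(CLINT \<omega>|M. iexp (\<Sum>k = 1..n. d n k * e k \<omega>)) = (\<Prod>k = 1..n. z n k)" for n
  proof -
    have "(CLINT \<omega>|M. iexp (\<Sum>k = 1..n. d n k * e k \<omega>)) = char (distr M borel (\<lambda>\<omega>. \<Sum>k = 1..n. d n k * e k \<omega>)) 1"
      unfolding char_def by (subst integral_distr) (auto intro!: borel_measurable_sum borel_measurable_times)
    also have "\<dots> = (\<Prod>k = 1..n. char (distr M borel (\<lambda>\<omega>. d n k * e k \<omega>)) 1)"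
      by (rule char_distr_sum, rule indep_vars_compose2[OF indep_vars_subset[OF indep]]) auto
    also have "\<dots> = (\<Prod>k = 1..n. z n k)"
    proof (rule prod.cong[OF refl])
      fix k assume "k \<in> {1..n}"
      then have [measurable]: "e k \<in> borel_measurable M" by simp
      show "char (distr M borel (\<lambda>\<omega>. d n k * e k \<omega>)) 1 = z n k"
        unfolding z_def char_def by (simp add: integral_distr)
    qed
    finally show ?thesis .
  qed
  have prod_g: "(\<Prod>k = 1..n. g n k) = complex_of_real (exp (- (\<sigma>\<^sup>2 * (\<Sum>k = 1..n. (d n k)\<^sup>2)) / 2))" for n
    unfolding g_def of_real_prod[symmetric]
    by (simp add: exp_sum[symmetric] sum_negf sum_distrib_left sum_divide_distrib)
  \<comment> \<open>Every error carries the factor \<open>(d n k)^2\<close>, so summation over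
    \<open>k\<close> meets only the bounded sum of squared weights. The part with
    \<open>\<eta>\<close> comes from the tail beyond \<open>c\<close>, the part with
    \<open>\<delta>\<close> from the size of the weight.\<close>
  have term_bound: "norm (z n k - g n k) \<le> (d n k)\<^sup>2 * (\<eta> + \<delta> * (c * \<sigma>\<^sup>2 / 6 + \<sigma>^4 / 4))"
    if k: "k \<ge> 1" and \<delta>: "\<bar>d n k\<bar> \<le> \<delta>" "\<delta> \<le> 1" and c: "c > 0"
      and tail: "(LINT \<omega>|M. (e k \<omega>)\<^sup>2 * indicator {\<omega>. \<bar>e k \<omega>\<bar> > c} \<omega>) \<le> \<eta>" for n k \<eta> \<delta> c
  proof -
    let ?d = "d n k"
    note [measurable] = rv[OF k]
    let ?I = "\<lambda>\<omega>. (e k \<omega>)\<^sup>2 * indicator {\<omega>. \<bar>e k \<omega>\<bar> > c} \<omega>"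
    have iI: "integrable M ?I"
      by (rule Bochner_Integration.integrable_bound[OF int2[OF k]]) (auto simp: indicator_def)
    \<comment> \<open>Beyond the cutoff the quadratic entry of the minimum is used; below it the
      cubic one, where one factor of the error is at most \<open>c\<close> and the weight is at most
      \<open>\<delta>\<close>.\<close>
    have "expectation (\<lambda>\<omega>. min (6 * (e k \<omega>)\<^sup>2) (\<bar>?d\<bar> * \<bar>e k \<omega>\<bar>^3)) \<le> expectation (\<lambda>\<omega>. 6 * ?I \<omega> + \<delta> * c * (e k \<omega>)\<^sup>2)"
    proof (rule integral_mono)
      show "integrable M (\<lambda>\<omega>. min (6 * (e k \<omega>)\<^sup>2) (\<bar>?d\<bar> * \<bar>e k \<omega>\<bar>^3))"
        by (rule Bochner_Integration.integrable_bound[OF integrable_mult_right[OF int2[OF k], of 6]]) auto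
      show "integrable M (\<lambda>\<omega>. 6 * ?I \<omega> + \<delta> * c * (e k \<omega>)\<^sup>2)" using iI int2[OF k] by auto
      fix \<omega>
      show "min (6 * (e k \<omega>)\<^sup>2) (\<bar>?d\<bar> * \<bar>e k \<omega>\<bar>^3) \<le> 6 * ?I \<omega> + \<delta> * c * (e k \<omega>)\<^sup>2"
      proof (cases "\<bar>e k \<omega>\<bar> > c")
        case True
        have "min (6 * (e k \<omega>)\<^sup>2) (\<bar>?d\<bar> * \<bar>e k \<omega>\<bar>^3) \<le> 6 * (e k \<omega>)\<^sup>2" by simp
        moreover have "0 \<le> \<delta> * c * (e k \<omega>)\<^sup>2" using \<delta> c by auto
        ultimately show ?thesis using True by simp
      next
        case False
        have "\<bar>?d\<bar> * \<bar>e k \<omega>\<bar>^3 = \<bar>?d\<bar> * \<bar>e k \<omega>\<bar> * (e k \<omega>)\<^sup>2"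
          by (simp add: eval_nat_numeral)
        also have "\<dots> \<le> \<delta> * c * (e k \<omega>)\<^sup>2"
          using False \<delta> c by (intro mult_right_mono mult_mono) auto
        finally show ?thesis using False by simp
      qed
    qed
    also have "\<dots> = 6 * expectation ?I + \<delta> * c * \<sigma>\<^sup>2" using iI int2[OF k] second[OF k] by simp
    also have "\<dots> \<le> 6 * \<eta> + \<delta> * c * \<sigma>\<^sup>2" using tail by simp
    finally have E: "expectation (\<lambda>\<omega>. min (6 * (e k \<omega>)\<^sup>2) (\<bar>?d\<bar> * \<bar>e k \<omega>\<bar>^3)) \<le> 6 * \<eta> + \<delta> * c * \<sigma>\<^sup>2" .
    have "norm (z n k - (1 - ?d\<^sup>2 * \<sigma>\<^sup>2 / 2)) \<le> (?d\<^sup>2 / 6) * expectation (\<lambda>\<omega>. min (6 * (e k \<omega>)\<^sup>2) (\<bar>?d\<bar> * \<bar>e k \<omega>\<bar>^3))"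
      unfolding z_def using int1[OF k] int2[OF k] mean[OF k] var[OF k] by (intro char_approx3') auto
    also have "\<dots> \<le> (?d\<^sup>2 / 6) * (6 * \<eta> + \<delta> * c * \<sigma>\<^sup>2)" by (intro mult_left_mono E) auto
    finally have 1: "norm (z n k - (1 - ?d\<^sup>2 * \<sigma>\<^sup>2 / 2)) \<le> (?d\<^sup>2 / 6) * (6 * \<eta> + \<delta> * c * \<sigma>\<^sup>2)" .
    let ?u = "\<sigma>\<^sup>2 * ?d\<^sup>2 / 2"
    have "complex_of_real (1 - ?u) - g n k = complex_of_real ((1 - ?u) - exp (- ?u))"
      by (simp add: g_def)
    then have "norm (complex_of_real (1 - ?u) - g n k) = \<bar>(1 - ?u) - exp (- ?u)\<bar>"
      by (simp only: norm_of_real)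
    also have "\<dots> \<le> ?u\<^sup>2" by (rule abs_exp_minus_bound) simp
    \<comment> \<open>Of the four powers of the weight, two are kept for summation, one is bounded
      by \<open>\<delta>\<close> and one by 1.\<close>
    also have "\<dots> = ?d\<^sup>2 * (\<bar>?d\<bar> * \<bar>?d\<bar>) * (\<sigma>^4 / 4)" by (simp add: power_mult_distrib power_divide power2_eq_square eval_nat_numeral)
    also have "\<dots> \<le> ?d\<^sup>2 * (\<delta> * 1) * (\<sigma>^4 / 4)"
      using \<delta> by (intro mult_right_mono mult_left_mono mult_mono) auto
    finally have 2: "norm (complex_of_real (1 - ?u) - g n k) \<le> ?d\<^sup>2 * \<delta> * (\<sigma>^4 / 4)" by simp
    have "norm (z n k - g n k) \<le> norm (z n k - (1 - ?d\<^sup>2 * \<sigma>\<^sup>2 / 2)) + norm (complex_of_real (1 - ?u) - g n k)"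
      using norm_triangle_ineq[of "z n k - (1 - ?d\<^sup>2 * \<sigma>\<^sup>2 / 2)" "complex_of_real (1 - ?u) - g n k"]
      by (simp add: mult.commute)
    with 1 2 have "norm (z n k - g n k) \<le> (?d\<^sup>2 / 6) * (6 * \<eta> + \<delta> * c * \<sigma>\<^sup>2) + ?d\<^sup>2 * \<delta> * (\<sigma>^4 / 4)" by linarith
    also have "\<dots> = ?d\<^sup>2 * (\<eta> + \<delta> * (c * \<sigma>\<^sup>2 / 6 + \<sigma>^4 / 4))" by (simp add: algebra_simps)
    finally show ?thesis .
  qed
  have diff: "(\<lambda>n. (\<Prod>k = 1..n. z n k) - (\<Prod>k = 1..n. g n k)) \<longlonglongrightarrow> 0"
  proof (rule tendstoI)
    fix \<theta> :: real assume \<theta>: "\<theta> > 0"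
    \<comment> \<open>\<open>B\<close> exceeds the limit \<open>w\<close>, so it eventually bounds
      the sums of squares. With \<open>\<delta> * q \<le> \<eta>\<close> the total error is at most
      \<open>2 * B * \<eta> = \<theta> / 2\<close>. The denominator \<open>q + 1\<close> below
      allows \<open>q = 0\<close>, which occurs for \<open>\<sigma> = 0\<close>.\<close>
    define B where "B = \<bar>w\<bar> + 1"
    have B: "B > 0" unfolding B_def by simp
    define \<eta> where "\<eta> = \<theta> / (4 * B)"
    have \<eta>: "\<eta> > 0" unfolding \<eta>_def using \<theta> B by simp
    obtain c where c: "c > 0" "\<And>k. k \<ge> 1 \<Longrightarrow> (LINT \<omega>|M. (e k \<omega>)\<^sup>2 * indicator {\<omega>. \<bar>e k \<omega>\<bar> > c} \<omega>) \<le> \<eta>"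
      using tails_negligibleD[OF tails \<eta> rv int2] by blast
    define q where "q = c * \<sigma>\<^sup>2 / 6 + \<sigma>^4 / 4"
    have q: "q \<ge> 0" unfolding q_def using c(1) by simp
    define \<delta> where "\<delta> = min 1 (\<eta> / (q + 1))"
    have \<delta>: "\<delta> > 0" "\<delta> \<le> 1" unfolding \<delta>_def using \<eta> q by auto
    have "\<delta> * q \<le> \<eta> / (q + 1) * (q + 1)" unfolding \<delta>_def using q \<eta> by (intro mult_mono) auto
    then have \<delta>q: "\<delta> * q \<le> \<eta>" using q by simp
    have "\<forall>\<^sub>F n in sequentially. (\<Sum>k = 1..n. (d n k)\<^sup>2) < B"
      using sq by (rule order_tendstoD) (simp add: B_def)
    with small[OF \<delta>(1)] show "\<forall>\<^sub>F n in sequentially. dist ((\<Prod>k = 1..n. z n k) - (\<Prod>k = 1..n. g n k)) 0 < \<theta>"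
    proof eventually_elim
      case (elim n)
      have "norm ((\<Prod>k = 1..n. z n k) - (\<Prod>k = 1..n. g n k)) \<le> (\<Sum>k = 1..n. norm (z n k - g n k))"
      proof (rule norm_prod_diff)
        fix k assume k: "k \<in> {1..n}"
        then have "real_distribution (distr M borel (e k))" by (intro real_distribution_distr rv) simp
        then show "norm (z n k) \<le> 1" unfolding z_def by (rule real_distribution.cmod_char_le_1)
        show "norm (g n k) \<le> 1" unfolding g_def norm_of_real by simp
      qed
      also have "\<dots> \<le> (\<Sum>k = 1..n. (d n k)\<^sup>2 * (\<eta> + \<delta> * q))"
        unfolding q_def using elim \<delta> c by (intro sum_mono term_bound) auto
      also have "\<dots> = (\<Sum>k = 1..n. (d n k)\<^sup>2) * (\<eta> + \<delta> * q)" by (simp add: sum_distrib_right)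
      also have "\<dots> \<le> B * (\<eta> + \<eta>)"
        using elim \<delta>q \<delta> \<eta> q B by (intro mult_mono add_mono) auto
      also have "\<dots> < \<theta>" unfolding \<eta>_def using B \<theta> by simp
      finally show ?case by simp
    qed
  qed
  have "(\<lambda>n. complex_of_real (exp (- (\<sigma>\<^sup>2 * (\<Sum>k = 1..n. (d n k)\<^sup>2)) / 2))) \<longlonglongrightarrow> complex_of_real (exp (- (\<sigma>\<^sup>2 * w) / 2))"
    by (intro tendsto_intros sq) auto
  from tendsto_add[OF diff this[folded prod_g]] show ?thesis
    unfolding prod_z by simp
qed

subsection \<open>Gram matrices and least squares weights\<close>

text \<open>For square matrices a right inverse is also a left inverse, which determines the value
  chosen by \<open>matrix_inv\<close>.\<close>

lemma matrix_inv_unique: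
  fixes A B :: "real ^ 'n::finite ^ 'n"
  assumes "A ** B = mat 1" shows "matrix_inv A = B"
proof -
  have "\<exists>C. A ** C = mat 1 \<and> C ** A = mat 1" using assms matrix_left_right_inverse by blast
  then have "matrix_inv A ** A = mat 1" unfolding matrix_inv_def by (rule someI2_ex) simp
  then have "matrix_inv A ** (A ** B) = B" by (simp add: matrix_mul_assoc)
  then show ?thesis using assms by simp
qed

lemma matrix_inv_mul:
  fixes A :: "real ^ 'n::finite ^ 'n"
  assumes "invertible A" shows "matrix_inv A ** A = mat 1" "A ** matrix_inv A = mat 1"
  using assms matrix_inv_unique matrix_left_right_inverse unfolding invertible_def by metis+

lemma tendsto_det:
  fixes A :: "nat \<Rightarrow> real ^ 'n::finite ^ 'n"
  assumes "\<And>i j. (\<lambda>n. A n $ i $ j) \<longlonglongrightarrow> B $ i $ j"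
  shows "(\<lambda>n. det (A n)) \<longlonglongrightarrow> det B"
  unfolding det_def by (intro tendsto_sum tendsto_mult tendsto_const tendsto_prod assms)

lemma matrix_tendstoI:
  fixes A :: "'a \<Rightarrow> real ^ 'n ^ 'm"
  assumes "\<And>i j. ((\<lambda>n. A n $ i $ j) \<longlongrightarrow> B $ i $ j) F"
  shows "(A \<longlongrightarrow> B) F"
  by (intro vec_tendstoI assms)

text \<open>The determinant is continuous, so it is eventually nonzero; by Cramer's rule the entries
  of the inverse are quotients of determinants and hence converge.\<close>

lemma tendsto_matrix_inv:
  fixes A :: "nat \<Rightarrow> real ^ 'n::finite ^ 'n"
  assumes lim: "A \<longlonglongrightarrow> B" and B: "invertible B"
  shows "\<forall>\<^sub>F n in sequentially. invertible (A n)" "(\<lambda>n. matrix_inv (A n)) \<longlonglongrightarrow> matrix_inv B"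
proof -
  have ent: "(\<lambda>n. A n $ i $ j) \<longlonglongrightarrow> B $ i $ j" for i j
    using tendsto_vec_nth[OF tendsto_vec_nth[OF lim]] .
  have dB: "det B \<noteq> 0" using B invertible_det_nz by blast
  have "\<forall>\<^sub>F n in sequentially. det (A n) \<noteq> 0"
    using tendsto_det[OF ent] dB by (rule tendsto_imp_eventually_ne)
  then show inv: "\<forall>\<^sub>F n in sequentially. invertible (A n)" by (simp add: invertible_det_nz)
  \<comment> \<open>Column \<open>l\<close> of the inverse solves the linear system with right-hand
    side \<open>axis l 1\<close>; \<open>cr A l k\<close> is Cramer's formula for its component
    \<open>k\<close>.\<close>
  define cr where "cr A l k = det (\<chi> i j. if j = k then axis l 1 $ i else A $ i $ j) / det A" for A :: "real ^ 'n ^ 'n" and l k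
  have cr: "matrix_inv A $ k $ l = cr A l k" if "invertible A" for A :: "real ^ 'n ^ 'n" and k l
  proof -
    have "A *v (matrix_inv A *v axis l 1) = axis l 1"
      using matrix_inv_mul[OF that] by (simp add: matrix_vector_mul_assoc)
    then have "matrix_inv A *v axis l 1 = (\<chi> k. cr A l k)"
      using that unfolding cr_def invertible_det_nz by (subst (asm) cramer) auto
    then have "(matrix_inv A *v axis l 1) $ k = cr A l k" by simp
    then show ?thesis by (simp add: matrix_vector_mul_component inner_axis' inner_axis)
  qed
  show "(\<lambda>n. matrix_inv (A n)) \<longlonglongrightarrow> matrix_inv B"
  proof (rule matrix_tendstoI)
    fix k l
    have "(\<lambda>n. cr (A n) l k) \<longlonglongrightarrow> cr B l k"
      unfolding cr_def by (intro tendsto_divide tendsto_det dB ent) (auto simp: ent)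
    moreover have "\<forall>\<^sub>F n in sequentially. cr (A n) l k = matrix_inv (A n) $ k $ l"
      using inv by eventually_elim (simp add: cr)
    ultimately show "(\<lambda>n. matrix_inv (A n) $ k $ l) \<longlonglongrightarrow> matrix_inv B $ k $ l"
      unfolding cr[OF B] by (rule Lim_transform_eventually)
  qed
qed

lemma gram_mult: "gram x n *v v = (\<Sum>k = 1..n. (x k \<bullet> v) *\<^sub>R x k)"
proof (rule vec_eq_iff[THEN iffD2], rule allI)
  fix i
  have "(gram x n *v v) $ i = (\<Sum>j\<in>UNIV. \<Sum>k = 1..n. x k $ i * x k $ j * v $ j)"
    by (simp add: matrix_vector_mult_def gram_def sum_distrib_right)
  also have "\<dots> = (\<Sum>k = 1..n. \<Sum>j\<in>UNIV. x k $ i * x k $ j * v $ j)" by (rule sum.swap)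
  also have "\<dots> = (\<Sum>k = 1..n. (x k \<bullet> v) *\<^sub>R x k) $ i"
    by (simp add: inner_vec_def sum_distrib_left sum_distrib_right mult_ac)
  finally show "(gram x n *v v) $ i = (\<Sum>k = 1..n. (x k \<bullet> v) *\<^sub>R x k) $ i" .
qed

lemma gram_quadratic: "v \<bullet> (gram x n *v v) = (\<Sum>k = 1..n. (x k \<bullet> v)\<^sup>2)"
  by (simp add: gram_mult inner_sum_right power2_eq_square inner_commute)

lemma transpose_gram: "transpose (gram x n) = gram x n"
  by (simp add: transpose_def gram_def vec_eq_iff mult.commute)

text \<open>The quadratic form of the Gram matrix is a sum of squares, so a kernel vector is
  orthogonal to all regressors; these span the space, so the vector is zero.\<close>

lemma design_rank_full_imp_invertible:
  fixes x :: "nat \<Rightarrow> real ^ 'p::finite"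
  assumes "design_rank x n = CARD('p)" shows "invertible (gram x n)"
proof -
  have sp: "span (x ` {1..n}) = UNIV"
    using assms eucl.dim_eq_full[of "x ` {1..n}"] unfolding design_rank_def by simp
  have "v = 0" if "gram x n *v v = 0" for v
  proof -
    have "(\<Sum>k = 1..n. (x k \<bullet> v)\<^sup>2) = 0" using gram_quadratic[of v x n] that by simp
    then have "\<forall>k\<in>{1..n}. x k \<bullet> v = 0" by (simp add: sum_nonneg_eq_0_iff)
    then have "orthogonal v y" if "y \<in> x ` {1..n}" for y
      using that by (auto simp: orthogonal_def inner_commute)
    then have "orthogonal v v" using orthogonal_to_span[of v "x ` {1..n}" v] sp by auto
    then show "v = 0" by (simp add: orthogonal_self)
  qed
  then show ?thesis unfolding invertible_left_inverse matrix_left_invertible_ker by blast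
qed

lemma symmetric_matrix_dot:
  fixes A :: "real ^ 'n::finite ^ 'n"
  assumes "transpose A = A" shows "u \<bullet> (A *v y) = (A *v u) \<bullet> y"
proof -
  have "A *v u = u v* A" using transpose_matrix_vector[of A u] assms by simp
  then show ?thesis by (simp add: dot_lmul_matrix)
qed

lemma ols_error:
  fixes x :: "nat \<Rightarrow> real ^ 'p::finite"
  assumes "invertible (gram x n)"
  shows "ols \<beta> x e n \<omega> - \<beta> = (\<Sum>k = 1..n. e k \<omega> *\<^sub>R (matrix_inv (gram x n) *v x k))"
proof -
  have "(\<Sum>k = 1..n. response \<beta> x e k \<omega> *\<^sub>R x k) = gram x n *v \<beta> + (\<Sum>k = 1..n. e k \<omega> *\<^sub>R x k)"
    by (simp add: response_def gram_mult scaleR_add_left sum.distrib)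
  then have "ols \<beta> x e n \<omega> = \<beta> + matrix_inv (gram x n) *v (\<Sum>k = 1..n. e k \<omega> *\<^sub>R x k)"
    by (simp add: ols_def matrix_vector_right_distrib matrix_vector_mul_assoc matrix_inv_mul[OF assms])
  also have "matrix_inv (gram x n) *v (\<Sum>k = 1..n. e k \<omega> *\<^sub>R x k) =
     (\<Sum>k = 1..n. e k \<omega> *\<^sub>R (matrix_inv (gram x n) *v x k))"
    by (simp add: linear_sum[OF matrix_vector_mul_linear] matrix_vector_mult_scaleR)
  finally show ?thesis by simp
qed

text \<open>A common form for both admissible normalizations, so that the analysis of the weights is
  done once.\<close>

definition diag_matrix :: "('p \<Rightarrow> real) \<Rightarrow> real ^ 'p ^ 'p" where
  "diag_matrix g = (\<chi> i j. if i = j then g i else 0)"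

lemma diag_matrix_mult_left: "(diag_matrix g ** A) $ i $ j = g i * A $ i $ j"
  by (simp add: diag_matrix_def matrix_matrix_mult_def if_distrib[of "\<lambda>x. x * _"] cong: if_cong)

lemma diag_matrix_mult_right: "(A ** diag_matrix g) $ i $ j = A $ i $ j * g j"
  by (simp add: diag_matrix_def matrix_matrix_mult_def if_distrib[of "\<lambda>x. _ * x"] cong: if_cong)

lemma diag_matrix_mult_vector: "(diag_matrix g *v v) $ i = g i * v $ i"
  by (simp add: diag_matrix_def matrix_vector_mult_def if_distrib[of "\<lambda>x. x * _"] cong: if_cong)

lemma transpose_diag_matrix: "transpose (diag_matrix g) = diag_matrix g"
  by (auto simp: transpose_def diag_matrix_def vec_eq_iff)

lemma diag_matrix_inverse:
  assumes "\<And>i. g i \<noteq> 0"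
  shows "diag_matrix g ** diag_matrix (\<lambda>i. 1 / g i) = mat 1"
    "diag_matrix (\<lambda>i. 1 / g i) ** diag_matrix g = mat 1"
  by (auto simp: vec_eq_iff diag_matrix_mult_left mat_def assms) (auto simp: diag_matrix_def assms)

text \<open>Beyond some index \<open>K\<close> the assumed ratio and monotonicity of
  \<open>g\<close> suffice; the finitely many earlier terms are dominated because \<open>g\<close>
  diverges.\<close>

lemma max_negligible:
  fixes a g :: "nat \<Rightarrow> real"
  assumes mono: "mono g" and lim: "filterlim g at_top sequentially"
    and neg: "(\<lambda>n. a n / g n) \<longlonglongrightarrow> 0" and \<delta>: "\<delta> > 0"
  shows "\<forall>\<^sub>F n in sequentially. \<forall>k\<in>{1..n}. \<bar>a k\<bar> \<le> \<delta> * g n"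
proof -
  have "\<forall>\<^sub>F n in sequentially. \<bar>a n / g n\<bar> < \<delta>"
    using tendsto_rabs_zero[OF neg] \<delta> by (rule order_tendstoD)
  then have "\<forall>\<^sub>F n in sequentially. \<bar>a n\<bar> \<le> \<delta> * g n"
    using filterlim_at_top_dense[THEN iffD1, OF lim, rule_format, of 0]
    by eventually_elim (simp add: abs_divide divide_less_eq)
  then obtain K where K: "\<And>n. n \<ge> K \<Longrightarrow> \<bar>a n\<bar> \<le> \<delta> * g n"
    unfolding eventually_sequentially by blast
  have "\<forall>\<^sub>F n in sequentially. (\<Sum>k<K. \<bar>a k\<bar>) / \<delta> \<le> g n"
    using lim unfolding filterlim_at_top by blast
  then show ?thesis
  proof eventually_elim
    case (elim n)
    show ?case
    proof
      fix k assume k: "k \<in> {1..n}"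
      show "\<bar>a k\<bar> \<le> \<delta> * g n"
      proof (cases "k < K")
        case True
        have "\<bar>a k\<bar> \<le> (\<Sum>k<K. \<bar>a k\<bar>)" using True by (intro member_le_sum) auto
        then show ?thesis using elim \<delta> by (simp add: field_simps)
      next
        case False
        have "g k \<le> g n" using mono k by (auto intro: monoD)
        then have "\<delta> * g k \<le> \<delta> * g n" using \<delta> by simp
        with K[of k] False show ?thesis by simp
      qed
    qed
  qed
qed

text \<open>Write \<open>G\<close>, \<open>H\<close> for the normalization and its inverse and
  \<open>M\<close> for the Gram matrix. Then \<open>G ** inv M ** G\<close> is the inverse of
  \<open>H ** M ** H\<close> and so tends to \<open>V\<close>. Its quadratic form at
  \<open>u\<close> is the sum of squared weights, and each weight is a bounded vector paired with
  \<open>H *v x k\<close>, which is uniformly small.\<close>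

lemma ols_weights:
  fixes x :: "nat \<Rightarrow> real ^ 'p::finite" and g :: "nat \<Rightarrow> 'p \<Rightarrow> real"
  assumes mono: "\<And>i. mono (\<lambda>n. g n i)" and lim: "\<And>i. filterlim (\<lambda>n. g n i) at_top sequentially"
    and neg: "\<And>i. (\<lambda>n. x n $ i / g n i) \<longlonglongrightarrow> 0"
    and V: "invertible V"
    and W: "(\<lambda>n. diag_matrix (\<lambda>i. 1 / g n i) ** gram x n ** diag_matrix (\<lambda>i. 1 / g n i)) \<longlonglongrightarrow> matrix_inv V"
  defines "d \<equiv> \<lambda>u n k. u \<bullet> (diag_matrix (g n) *v (matrix_inv (gram x n) *v x k))"
  shows "\<forall>\<^sub>F n in sequentially. invertible (gram x n)"
    and "(\<lambda>n. \<Sum>k = 1..n. (d u n k)\<^sup>2) \<longlonglongrightarrow> u \<bullet> (V *v u)"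
    and "\<delta> > 0 \<Longrightarrow> \<forall>\<^sub>F n in sequentially. \<forall>k\<in>{1..n}. \<bar>d u n k\<bar> \<le> \<delta>"
proof -
  let ?G = "\<lambda>n. diag_matrix (g n)" and ?H = "\<lambda>n. diag_matrix (\<lambda>i. 1 / g n i)"
  let ?M = "\<lambda>n. gram x n"
  let ?W = "\<lambda>n. ?H n ** ?M n ** ?H n" and ?P = "\<lambda>n. ?G n ** matrix_inv (?M n) ** ?G n"
  have invV: "invertible (matrix_inv V)" "matrix_inv (matrix_inv V) = V"
    using matrix_inv_mul[OF V] by (auto simp: invertible_def intro: matrix_inv_unique)
  note W' = tendsto_matrix_inv[OF W invV(1)]
  have pos: "\<forall>\<^sub>F n in sequentially. \<forall>i. g n i > 0"
  proof (rule eventually_all_finite)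
    show "\<forall>\<^sub>F n in sequentially. g n i > 0" for i using lim[of i] unfolding filterlim_at_top_dense by blast
  qed
  \<comment> \<open>Since \<open>G\<close> and \<open>H\<close> are mutually inverse,
    \<open>M = G ** W ** G\<close>, so invertibility passes from the convergent \<open>W\<close> to
    the Gram matrix.\<close>
  have key: "\<forall>\<^sub>F n in sequentially. (\<forall>i. g n i > 0) \<and> invertible (?M n) \<and> ?P n = matrix_inv (?W n)"
    using W'(1) pos
  proof eventually_elim
    case (elim n)
    have ne: "\<And>i. g n i \<noteq> 0" using elim(2)[rule_format] by (simp add: less_imp_neq[THEN not_sym])
    note GH = diag_matrix_inverse[of "g n", OF ne]
    have "?G n ** ?W n ** ?G n = (?G n ** ?H n) ** ?M n ** (?H n ** ?G n)" by (simp add: matrix_mul_assoc)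
    then have M: "?M n = ?G n ** ?W n ** ?G n" using GH by simp
    have "invertible (?G n)" unfolding invertible_def using GH by blast
    then have "invertible (?G n ** ?W n ** ?G n)" by (intro invertible_mult elim)
    then have Minv: "invertible (?M n)" using M by simp
    have "?W n ** ?P n = ?H n ** ?M n ** (?H n ** ?G n) ** matrix_inv (?M n) ** ?G n" by (simp add: matrix_mul_assoc)
    also have "\<dots> = ?H n ** (?M n ** matrix_inv (?M n)) ** ?G n" using GH by (simp add: matrix_mul_assoc)
    also have "\<dots> = mat 1" using matrix_inv_mul[OF Minv] GH by simp
    finally have "matrix_inv (?W n) = ?P n" by (rule matrix_inv_unique)
    then show ?case using elim Minv by simp
  qed
  show "\<forall>\<^sub>F n in sequentially. invertible (?M n)" using key by eventually_elim simp
  have P: "?P \<longlonglongrightarrow> V"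
    using W'(2) unfolding invV(2) by (rule Lim_transform_eventually) (use key in eventually_elim, simp)
  have symG: "u \<bullet> (?G n *v y) = (?G n *v u) \<bullet> y" for u y n
    by (rule symmetric_matrix_dot[OF transpose_diag_matrix])
  have symM: "u \<bullet> (matrix_inv (?M n) *v y) = (matrix_inv (?M n) *v u) \<bullet> y" if "invertible (?M n)" for u y n
  proof -
    have "?M n ** transpose (matrix_inv (?M n)) = transpose (matrix_inv (?M n) ** ?M n)"
      by (simp add: matrix_transpose_mul transpose_gram)
    also have "\<dots> = mat 1" by (simp add: matrix_inv_mul[OF that] transpose_mat)
    finally have "matrix_inv (?M n) = transpose (matrix_inv (?M n))" by (rule matrix_inv_unique)
    then show ?thesis by (intro symmetric_matrix_dot) (rule sym)
  qed
  have tv: "(\<lambda>n. A n *v u) \<longlonglongrightarrow> B *v u" if "A \<longlonglongrightarrow> B" for A and B :: "real ^ 'p ^ 'p" and u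
    unfolding matrix_vector_mult_def using that
    by (intro vec_tendstoI) (auto intro!: tendsto_sum tendsto_mult tendsto_vec_nth)
  have "(\<lambda>n. u \<bullet> (?P n *v u)) \<longlonglongrightarrow> u \<bullet> (V *v u)" by (intro tendsto_inner tendsto_const tv P)
  then show "(\<lambda>n. \<Sum>k = 1..n. (d u n k)\<^sup>2) \<longlonglongrightarrow> u \<bullet> (V *v u)"
  proof (rule Lim_transform_eventually)
    show "\<forall>\<^sub>F n in sequentially. u \<bullet> (?P n *v u) = (\<Sum>k = 1..n. (d u n k)\<^sup>2)"
      using key
    proof eventually_elim
      case (elim n)
      \<comment> \<open>By symmetry both matrices move onto \<open>u\<close>, so the weight is
        \<open>x k \<bullet> ?v\<close> and the sum of squares is the Gram quadratic form at
        \<open>?v\<close>.\<close>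
      let ?v = "matrix_inv (?M n) *v (?G n *v u)"
      have "d u n k = x k \<bullet> ?v" for k
      proof -
        have "d u n k = (?G n *v u) \<bullet> (matrix_inv (?M n) *v x k)" unfolding d_def by (rule symG)
        also have "\<dots> = ?v \<bullet> x k" using elim by (intro symM) simp
        finally show ?thesis by (simp only: inner_commute)
      qed
      then have "(\<Sum>k = 1..n. (d u n k)\<^sup>2) = ?v \<bullet> (?M n *v ?v)" by (simp add: gram_quadratic)
      also have "?M n *v ?v = ?G n *v u" using elim by (simp add: matrix_vector_mul_assoc matrix_inv_mul matrix_mul_assoc)
      also have "?v \<bullet> (?G n *v u) = u \<bullet> (?G n *v ?v)"
        unfolding symG[of u n ?v] by (rule inner_commute)
      also have "\<dots> = u \<bullet> (?P n *v u)" by (simp add: matrix_vector_mul_assoc matrix_mul_assoc)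
      finally show ?case by simp
    qed
  qed
  show "\<forall>\<^sub>F n in sequentially. \<forall>k\<in>{1..n}. \<bar>d u n k\<bar> \<le> \<delta>" if \<delta>: "\<delta> > 0"
  proof -
    have "(\<lambda>n. norm (transpose (?P n) *v u)) \<longlonglongrightarrow> norm (transpose V *v u)"
      using P by (intro tendsto_norm tv matrix_tendstoI) (auto simp: transpose_def intro!: tendsto_vec_nth)
    then have C: "\<forall>\<^sub>F n in sequentially. norm (transpose (?P n) *v u) < norm (transpose V *v u) + 1"
      by (rule order_tendstoD) simp
    define C where "C = norm (transpose V *v u) + 1"
    have C0: "C > 0" unfolding C_def by (simp add: add_nonneg_pos)
    define \<eta> where "\<eta> = \<delta> / (C * real CARD('p))"
    have \<eta>: "\<eta> > 0" unfolding \<eta>_def using \<delta> C0 by simp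
    have "\<forall>\<^sub>F n in sequentially. \<forall>i. \<forall>k\<in>{1..n}. \<bar>x k $ i\<bar> \<le> \<eta> * g n i"
      by (intro eventually_all_finite max_negligible mono lim neg \<eta>)
    with key C show ?thesis
    proof eventually_elim
      case (elim n)
      show ?case
      proof
        fix k assume k: "k \<in> {1..n}"
        have ne: "\<And>i. g n i \<noteq> 0" using elim(1) by (simp add: less_imp_neq[THEN not_sym])
        \<comment> \<open>The identity \<open>G ** H\<close> is inserted in front of the regressor
          to bring in the convergent matrix \<open>?P n\<close>.\<close>
        have "?G n *v (matrix_inv (?M n) *v x k) = (?G n ** matrix_inv (?M n) ** (?G n ** ?H n)) *v x k"
          using diag_matrix_inverse[of "g n", OF ne] by (simp add: matrix_vector_mul_assoc)
        also have "\<dots> = ?P n *v (?H n *v x k)" by (simp add: matrix_vector_mul_assoc matrix_mul_assoc)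
        finally have "d u n k = (transpose (?P n) *v u) \<bullet> (?H n *v x k)"
          unfolding d_def by (simp add: dot_lmul_matrix)
        then have "\<bar>d u n k\<bar> \<le> norm (transpose (?P n) *v u) * norm (?H n *v x k)"
          by (simp only: Cauchy_Schwarz_ineq2)
        also have "\<dots> \<le> C * (real CARD('p) * \<eta>)"
        proof (intro mult_mono)
          show "norm (transpose (?P n) *v u) \<le> C" using elim(2) unfolding C_def by simp
          have "norm (?H n *v x k) \<le> (\<Sum>i\<in>UNIV. \<bar>(?H n *v x k) $ i\<bar>)" by (rule norm_le_l1_cart)
          also have "\<dots> \<le> (\<Sum>i\<in>(UNIV::'p set). \<eta>)"
          proof (rule sum_mono)
            fix i
            have "\<bar>x k $ i\<bar> \<le> \<eta> * g n i" "g n i > 0" using elim k by auto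
            then show "\<bar>(?H n *v x k) $ i\<bar> \<le> \<eta>" by (simp add: diag_matrix_mult_vector abs_divide divide_le_eq)
          qed
          finally show "norm (?H n *v x k) \<le> real CARD('p) * \<eta>" by simp
        qed (use C0 in auto)
        also have "\<dots> = \<delta>" unfolding \<eta>_def using C0 by simp
        finally show "\<bar>d u n k\<bar> \<le> \<delta>" .
      qed
    qed
  qed
qed

section \<open>The two admissible normalizations under one set of conditions\<close>

lemma gram_diagonal: "gram x n $ i $ i = (\<Sum>k = 1..n. (x k $ i)\<^sup>2)"
  by (simp add: gram_def power2_eq_square)

lemma mono_gram_diagonal: "mono (\<lambda>n. gram x n $ i $ i)"
  unfolding gram_diagonal by (intro monoI sum_mono2) auto

lemma tendsto_abs_of_square:
  fixes f :: "nat \<Rightarrow> real"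
  assumes "(\<lambda>n. (f n)\<^sup>2) \<longlonglongrightarrow> 0" shows "f \<longlonglongrightarrow> 0"
  using tendsto_real_sqrt[OF assms] by (simp add: tendsto_rabs_zero_iff)

text \<open>Both cases yield a diagonal, monotone, divergent scaling with negligible regressors. For
  the scaling by \<open>sqrt n\<close> negligibility is derived from convergence of the averaged
  Gram matrix.\<close>

lemma admissible_normalizationE:
  fixes x :: "nat \<Rightarrow> real ^ 'p::finite"
  assumes "admissible_normalization M x \<epsilon> \<Gamma> V"
  obtains g where "\<And>n. \<Gamma> n = diag_matrix (g n)" "\<And>i. mono (\<lambda>n. g n i)"
    "\<And>i. filterlim (\<lambda>n. g n i) at_top sequentially" "\<And>i. (\<lambda>n. x n $ i / g n i) \<longlonglongrightarrow> 0" "invertible V"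
    "(\<lambda>n. diag_matrix (\<lambda>i. 1 / g n i) ** gram x n ** diag_matrix (\<lambda>i. 1 / g n i)) \<longlonglongrightarrow> matrix_inv V"
  using assms unfolding admissible_normalization_def
proof (elim disjE conjE)
  assume adm: "admissible_diag M x \<epsilon> V" and \<Gamma>: "\<forall>n. \<Gamma> n = diag_norm x n"
  define g where "g n i = sqrt (gram x n $ i $ i)" for n i
  have dn: "diag_norm x n = diag_matrix (g n)" for n
    by (simp add: diag_norm_def diag_matrix_def g_def vec_eq_iff)
  have gmono: "mono (\<lambda>n. g n i)" for i
    using mono_gram_diagonal[of x i] unfolding g_def mono_def by auto
  have dlim: "filterlim (\<lambda>n. gram x n $ i $ i) at_top sequentially" for i
    using adm unfolding admissible_diag_def diag_diverges_def by blast
  have glim: "filterlim (\<lambda>n. g n i) at_top sequentially" for i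
    unfolding g_def by (rule filterlim_compose[OF sqrt_at_top dlim])
  have "(\<lambda>n. x n $ i / g n i) \<longlonglongrightarrow> 0" for i
  \<comment> \<open>The assumption divides the regressor at \<open>n + 1\<close> by the diagonal
    entry at \<open>n\<close>, whereas the scaling uses the entry at \<open>n + 1\<close>; the
    latter is larger, so the ratio only decreases.\<close>
  proof (rule LIMSEQ_imp_Suc, rule tendsto_abs_of_square, rule tendsto_sandwich[where f="\<lambda>_. 0"])
    show "(\<lambda>n. (x (n + 1) $ i)\<^sup>2 / gram x n $ i $ i) \<longlonglongrightarrow> 0"
      using adm unfolding admissible_diag_def regressor_negligible_def by blast
    have "\<forall>\<^sub>F n in sequentially. gram x n $ i $ i > 0"
      using dlim[of i] unfolding filterlim_at_top_dense by blast
    then show "\<forall>\<^sub>F n in sequentially. (x (Suc n) $ i / g (Suc n) i)\<^sup>2 \<le> (x (n + 1) $ i)\<^sup>2 / gram x n $ i $ i"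
    proof eventually_elim
      case (elim n)
      have le: "gram x n $ i $ i \<le> gram x (Suc n) $ i $ i" by (rule monoD[OF mono_gram_diagonal]) simp
      have "(x (Suc n) $ i / g (Suc n) i)\<^sup>2 = (x (n + 1) $ i)\<^sup>2 / gram x (Suc n) $ i $ i"
        using le elim unfolding g_def by (simp add: power_divide)
      also have "\<dots> \<le> (x (n + 1) $ i)\<^sup>2 / gram x n $ i $ i"
        using le elim by (intro divide_left_mono) auto
      finally show ?case .
    qed
  qed auto
  moreover have "(\<lambda>n. diag_matrix (\<lambda>i. 1 / g n i) ** gram x n ** diag_matrix (\<lambda>i. 1 / g n i)) \<longlonglongrightarrow> matrix_inv V"
  proof (rule Lim_transform_eventually)
    show "(\<lambda>n. matrix_inv (diag_norm x n) ** gram x n ** matrix_inv (diag_norm x n)) \<longlonglongrightarrow> matrix_inv V"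
      using adm unfolding admissible_diag_def normalized_gram_limit_def by blast
    have "\<forall>\<^sub>F n in sequentially. \<forall>i. g n i > 0"
    proof (rule eventually_all_finite)
      show "\<forall>\<^sub>F n in sequentially. g n i > 0" for i using glim[of i] unfolding filterlim_at_top_dense by blast
    qed
    then show "\<forall>\<^sub>F n in sequentially. matrix_inv (diag_norm x n) ** gram x n ** matrix_inv (diag_norm x n) =
       diag_matrix (\<lambda>i. 1 / g n i) ** gram x n ** diag_matrix (\<lambda>i. 1 / g n i)"
    proof eventually_elim
      case (elim n)
      have "\<And>i. g n i \<noteq> 0" using elim by (simp add: less_imp_neq[THEN not_sym])
      then show ?case by (simp add: dn matrix_inv_unique[OF diag_matrix_inverse(1)])
    qed
  qed
  moreover have "invertible V" using adm unfolding admissible_diag_def normalized_gram_limit_def by blast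
  ultimately show ?thesis using \<Gamma> dn gmono glim that by simp
next
  assume adm: "admissible_mean M x \<epsilon> V" and \<Gamma>: "\<forall>n. \<Gamma> n = mat (sqrt (real n))"
  define g where "g n i = sqrt (real n)" for n and i :: 'p
  have V: "invertible V" and lim: "(\<lambda>n. (1 / real n) *\<^sub>R gram x n) \<longlonglongrightarrow> matrix_inv V"
    using adm unfolding admissible_mean_def mean_gram_limit_def by auto
  have "mat (sqrt (real n)) = diag_matrix (g n)" for n
    by (simp add: mat_def diag_matrix_def g_def vec_eq_iff)
  moreover have "mono (\<lambda>n. g n i)" for i unfolding g_def mono_def by simp
  moreover have "filterlim (\<lambda>n. g n i) at_top sequentially" for i
    unfolding g_def by (rule filterlim_compose[OF sqrt_at_top filterlim_real_sequentially])
  moreover have "diag_matrix (\<lambda>i. 1 / g n i) ** gram x n ** diag_matrix (\<lambda>i. 1 / g n i) = (1 / real n) *\<^sub>R gram x n" for n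
    by (simp add: vec_eq_iff diag_matrix_mult_left diag_matrix_mult_right g_def field_simps flip: real_sqrt_mult)
  moreover have "(\<lambda>n. x n $ i / g n i) \<longlonglongrightarrow> 0" for i
  proof (rule LIMSEQ_imp_Suc, rule tendsto_abs_of_square)
    let ?m = "\<lambda>n. (1 / real n) * gram x n $ i $ i"
    have m: "?m \<longlonglongrightarrow> matrix_inv V $ i $ i"
      using tendsto_vec_nth[OF tendsto_vec_nth[OF lim]] by simp
    have r: "(\<lambda>n. real n / real (Suc n)) \<longlonglongrightarrow> 1" by real_asymp
    \<comment> \<open>The average at \<open>n + 1\<close> minus the rescaled average at
      \<open>n\<close> leaves exactly the newest squared regressor over
      \<open>n + 1\<close>.\<close>
    have "(\<lambda>n. ?m (Suc n) - ?m n * (real n / real (Suc n))) \<longlonglongrightarrow> matrix_inv V $ i $ i - matrix_inv V $ i $ i * 1"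
      by (intro tendsto_diff tendsto_mult m r LIMSEQ_Suc[OF m])
    then have "(\<lambda>n. ?m (Suc n) - ?m n * (real n / real (Suc n))) \<longlonglongrightarrow> 0" by simp
    then show "(\<lambda>n. (x (Suc n) $ i / g (Suc n) i)\<^sup>2) \<longlonglongrightarrow> 0"
    proof (rule Lim_transform_eventually)
      show "\<forall>\<^sub>F n in sequentially. ?m (Suc n) - ?m n * (real n / real (Suc n)) = (x (Suc n) $ i / g (Suc n) i)\<^sup>2"
        using eventually_gt_at_top[of 0]
      proof eventually_elim
        case (elim n)
        then show ?case by (simp add: g_def gram_diagonal power_divide add_divide_distrib)
      qed
    qed
  qed
  ultimately show ?thesis using \<Gamma> V lim that[of g] by simp
qed

section \<open>Growth bounds and uniform integrability\<close>

text \<open>Passing through the largest coordinate, \<open>(1 + norm y)^2\<close> is at most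
  \<open>2 * CARD('k)\<close> times its \<open>1 + (y $ j)^2\<close>; the power of a maximum is at
  most the sum of the powers. Coordinatewise moment bounds thus control the norm.\<close>

lemma norm_powr_le_sum:
  fixes y :: "real ^ 'k::finite"
  assumes "R \<ge> 0"
  shows "(1 + norm y) powr R \<le> (2 * real CARD('k)) powr (R/2) * (\<Sum>j\<in>UNIV. (1 + (y $ j)\<^sup>2) powr (R/2))"
proof -
  let ?a = "\<lambda>j. 1 + (y $ j)\<^sup>2"
  have "Max (range ?a) \<in> range ?a" by (rule Max_in) auto
  then obtain j0 where j0: "Max (range ?a) = ?a j0" by (rule imageE)
  have max: "?a j \<le> ?a j0" for j unfolding j0[symmetric] by (rule Max_ge) auto
  have "(norm y)\<^sup>2 = (\<Sum>j\<in>UNIV. (y $ j)\<^sup>2)"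
    unfolding norm_vec_def L2_set_def by (simp add: sum_nonneg)
  moreover have "1 \<le> real CARD('k)" by (simp add: Suc_leI)
  ultimately have "1 + (norm y)\<^sup>2 \<le> (\<Sum>j\<in>UNIV. ?a j)" by (simp add: sum.distrib)
  also have "\<dots> \<le> (\<Sum>j\<in>(UNIV::'k set). ?a j0)" by (intro sum_mono max)
  finally have 1: "1 + (norm y)\<^sup>2 \<le> real CARD('k) * ?a j0" by simp
  have "(1 + norm y)\<^sup>2 \<le> 2 * (1 + (norm y)\<^sup>2)"
    using sum_squares_bound[of 1 "norm y"] by (simp add: power2_sum)
  also have "\<dots> \<le> 2 * (real CARD('k) * ?a j0)" using 1 by (rule mult_left_mono) simp
  finally have 2: "(1 + norm y)\<^sup>2 \<le> 2 * real CARD('k) * ?a j0" by (simp only: mult.assoc)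
  have "(1 + norm y) powr R = ((1 + norm y)\<^sup>2) powr (R/2)"
    using abs_powr_square[of "1 + norm y" R] by (simp add: abs_of_nonneg)
  also have "\<dots> \<le> (2 * real CARD('k) * ?a j0) powr (R/2)"
    using 2 assms by (intro powr_mono2) auto
  also have "\<dots> = (2 * real CARD('k)) powr (R/2) * ?a j0 powr (R/2)" by (simp add: powr_mult)
  also have "\<dots> \<le> (2 * real CARD('k)) powr (R/2) * (\<Sum>j\<in>UNIV. ?a j powr (R/2))"
    by (intro mult_left_mono member_le_sum) auto
  finally show ?thesis .
qed

text \<open>Large values of \<open>Z n\<close> force \<open>norm (X n)\<close> to be large, and
  there growth of order \<open>s\<close> is a small fraction of the integrable weight of order
  \<open>R\<close>.\<close>

lemma uniformly_integrable_powr_bound: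
  fixes X :: "nat \<Rightarrow> 'a \<Rightarrow> real ^ 'k::finite"
  assumes meas: "\<And>n. n \<in> I \<Longrightarrow> Z n \<in> borel_measurable M"
    and intX: "\<And>n. integrable M (\<lambda>\<omega>. (1 + norm (X n \<omega>)) powr R)"
    and boundX: "\<And>n. (LINT \<omega>|M. (1 + norm (X n \<omega>)) powr R) \<le> B"
    and Z: "\<And>n \<omega>. n \<in> I \<Longrightarrow> \<bar>Z n \<omega>\<bar> \<le> (1 + norm (X n \<omega>)) powr s" and s: "0 \<le> s" "s < R"
  shows "uniformly_integrable M I Z"
  unfolding uniformly_integrable_def
proof (intro conjI ballI meas order_tendstoI)
  let ?S = "\<lambda>c. SUP n\<in>I. \<integral>\<^sup>+ \<omega>. ennreal \<bar>Z n \<omega>\<bar> * indicator {\<omega>. \<bar>Z n \<omega>\<bar> > c} \<omega> \<partial>M"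
  fix a :: ennreal assume "0 < a"
  \<comment> \<open>The supremum is only bounded weakly, so room is left below \<open>a\<close>;
    \<open>b\<close> is also finite when \<open>a\<close> is not.\<close>
  then obtain b where b: "0 < b" "b < a" using dense by blast
  then have "b < top" by (meson less_le_trans top_greatest)
  then obtain \<eta> where \<eta>: "b = ennreal \<eta>" "\<eta> > 0" using b(1) by (cases b) auto
  have B0: "B \<ge> 0" by (rule order_trans[OF _ boundX[of 0]]) simp
  define d where "d = \<eta> / (B + 1)"
  have d: "d > 0" "d * B \<le> \<eta>" unfolding d_def using \<eta>(2) B0 by (auto simp: field_simps)
  obtain K where K: "K \<ge> 0" "\<And>u. u \<ge> K \<Longrightarrow> (1 + u) powr s \<le> d * (1 + u) powr R"
    using powr_dominated[OF s(2) d(1)] by blast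
  show "\<forall>\<^sub>F c in at_top. ?S c < a"
    using eventually_ge_at_top[of "(1 + K) powr s"]
  proof eventually_elim
    case (elim c)
    have "?S c \<le> b"
    proof (rule SUP_least)
      fix n assume n: "n \<in> I"
      have "(\<integral>\<^sup>+ \<omega>. ennreal \<bar>Z n \<omega>\<bar> * indicator {\<omega>. \<bar>Z n \<omega>\<bar> > c} \<omega> \<partial>M) \<le>
          (\<integral>\<^sup>+ \<omega>. ennreal (d * (1 + norm (X n \<omega>)) powr R) \<partial>M)"
      proof (rule nn_integral_mono)
        fix \<omega>
        show "ennreal \<bar>Z n \<omega>\<bar> * indicator {\<omega>. \<bar>Z n \<omega>\<bar> > c} \<omega> \<le> ennreal (d * (1 + norm (X n \<omega>)) powr R)"
        proof (cases "\<bar>Z n \<omega>\<bar> > c")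
          case True
          have "K \<le> norm (X n \<omega>)"
          proof (rule ccontr)
            assume "\<not> K \<le> norm (X n \<omega>)"
            then have "(1 + norm (X n \<omega>)) powr s \<le> (1 + K) powr s" using s by (intro powr_mono2) auto
            with Z[OF n, of \<omega>] True elim show False by linarith
          qed
          from K(2)[OF this] Z[OF n, of \<omega>] True show ?thesis by (auto intro!: ennreal_leI)
        qed simp
      qed
      also have "\<dots> = ennreal (LINT \<omega>|M. d * (1 + norm (X n \<omega>)) powr R)"
        using d by (intro nn_integral_eq_integral integrable_mult_right intX) auto
      also have "\<dots> \<le> b" unfolding \<eta>(1)
        using boundX[of n] d by (intro ennreal_leI) (simp add: order_trans[OF mult_left_mono])
      finally show "(\<integral>\<^sup>+ \<omega>. ennreal \<bar>Z n \<omega>\<bar> * indicator {\<omega>. \<bar>Z n \<omega>\<bar> > c} \<omega> \<partial>M) \<le> b" .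
    qed
    then show ?case using b(2) by (rule le_less_trans)
  qed
qed auto

lemma prod_powr_bound:
  fixes h :: "'k::finite \<Rightarrow> real"
  assumes "\<And>j. \<bar>h j\<bar> \<le> (1 + u) powr r j" "u \<ge> 0"
  shows "\<bar>\<Prod>j\<in>UNIV. h j\<bar> \<le> (1 + u) powr (\<Sum>j\<in>UNIV. r j)"
proof -
  have "\<bar>\<Prod>j\<in>UNIV. h j\<bar> \<le> (\<Prod>j\<in>UNIV. (1 + u) powr r j)"
    unfolding abs_prod using assms(1) by (intro prod_mono) auto
  also have "\<dots> = (1 + u) powr (\<Sum>j\<in>UNIV. r j)" using assms(2) by (simp add: powr_sum)
  finally show ?thesis .
qed

lemma abs_powr_le:
  assumes "r \<ge> 0" shows "\<bar>abs_powr (y $ j) r\<bar> \<le> (1 + norm (y :: real ^ 'k::finite)) powr r"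
proof -
  have "\<bar>y $ j\<bar> powr r \<le> (1 + norm y) powr r"
    using component_le_norm_cart[of y j] assms by (intro powr_mono2) auto
  moreover have "1 + norm y > 0" by (simp add: add_pos_nonneg)
  ultimately show ?thesis by (simp add: abs_powr_def)
qed

text \<open>For \<open>r = 0\<close> the convention \<open>0^0 = 1\<close> makes the function
  constant; \<open>powr\<close> alone would jump at 0.\<close>

lemma continuous_abs_powr: "r \<ge> 0 \<Longrightarrow> continuous_on UNIV (\<lambda>y :: real ^ 'k::finite. abs_powr (y $ j) r)"
  by (cases "r = 0") (auto simp: abs_powr_def intro!: continuous_intros continuous_on_powr')

lemma power_le_powr: "\<bar>(y $ j) ^ q\<bar> \<le> (1 + norm (y :: real ^ 'k::finite)) powr real q"
proof -
  have "\<bar>(y $ j) ^ q\<bar> \<le> (1 + norm y) ^ q"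
    unfolding power_abs using component_le_norm_cart[of y j] by (intro power_mono) auto
  then show ?thesis by (simp add: powr_realpow add_pos_nonneg)
qed

theorem theorem2:
  fixes M :: "'a measure" and N :: "'b measure"
    and R \<sigma> :: real
    and \<beta> :: "real ^ 'p::finite" and x :: "nat \<Rightarrow> real ^ 'p" and \<epsilon> :: "nat \<Rightarrow> 'a \<Rightarrow> real"
    and \<Gamma> :: "nat \<Rightarrow> real ^ 'p ^ 'p" and V :: "real ^ 'p ^ 'p"
    and \<alpha> :: "'k::finite \<Rightarrow> real ^ 'p" and A :: "real ^ 'p ^ 'k"
    and \<xi>n :: "nat \<Rightarrow> 'k \<Rightarrow> 'a \<Rightarrow> real" and \<xi> :: "'b \<Rightarrow> real ^ 'k"
  assumes R: "R \<ge> 2"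
    and model: "in_LM R M x \<epsilon> \<sigma>"
    and norm: "admissible_normalization M x \<epsilon> \<Gamma> V"
    and \<alpha>: "\<And>j. \<alpha> j \<noteq> 0"
    and A: "A = (\<chi> j. \<alpha> j)"
    and \<xi>n: "\<And>n j \<omega>. \<xi>n n j \<omega> = \<alpha> j \<bullet> (\<Gamma> n *v (ols \<beta> x \<epsilon> n \<omega> - \<beta>))"
    and N: "prob_space N" and \<xi>_meas: "\<xi> \<in> borel_measurable N"
    and \<xi>: "multivariate_normal (distr N borel \<xi>) 0 (\<sigma>\<^sup>2 *\<^sub>R (A ** V ** transpose A))"
  shows "(\<forall>r :: 'k \<Rightarrow> real. (\<forall>j. r j \<ge> 0) \<and> (\<Sum>j\<in>UNIV. r j) < R \<longrightarrow>
           uniformly_integrable M {n. design_rank x n = CARD('p)}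
             (\<lambda>n \<omega>. \<Prod>j\<in>UNIV. abs_powr (\<xi>n n j \<omega>) (r j)) \<and>
           (\<lambda>n. prob_space.expectation M (\<lambda>\<omega>. \<Prod>j\<in>UNIV. abs_powr (\<xi>n n j \<omega>) (r j)))
             \<longlonglongrightarrow> prob_space.expectation N (\<lambda>\<omega>. \<Prod>j\<in>UNIV. abs_powr (\<xi> \<omega> $ j) (r j))) \<and>
         (\<forall>q :: 'k \<Rightarrow> nat. (\<Sum>j\<in>UNIV. real (q j)) < R \<longrightarrow>
           (\<lambda>n. prob_space.expectation M (\<lambda>\<omega>. \<Prod>j\<in>UNIV. \<xi>n n j \<omega> ^ q j))
             \<longlonglongrightarrow> prob_space.expectation N (\<lambda>\<omega>. \<Prod>j\<in>UNIV. (\<xi> \<omega> $ j) ^ q j))"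
proof -
  have EM: "error_model M \<epsilon> \<sigma>" and sup: "(SUP i\<in>{1..}. \<integral>\<^sup>+ \<omega>. ennreal (\<bar>\<epsilon> i \<omega>\<bar> powr R) \<partial>M) < \<infinity>"
    using model unfolding in_LM_def by auto
  interpret prob_space M using EM unfolding error_model_def by blast
  have indep: "indep_vars (\<lambda>_. borel) \<epsilon> {1..}"
    and int1: "\<And>k. k \<ge> 1 \<Longrightarrow> integrable M (\<epsilon> k)" and mean: "\<And>k. k \<ge> 1 \<Longrightarrow> expectation (\<epsilon> k) = 0"
    and int2: "\<And>k. k \<ge> 1 \<Longrightarrow> integrable M (\<lambda>\<omega>. (\<epsilon> k \<omega>)\<^sup>2)"
    and var: "\<And>k. k \<ge> 1 \<Longrightarrow> variance (\<epsilon> k) = \<sigma>\<^sup>2"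
    using EM unfolding error_model_def by auto
  have tails: "tails_negligible M \<epsilon>"
    using norm unfolding admissible_normalization_def admissible_diag_def admissible_mean_def by blast
  have rv[measurable]: "\<epsilon> k \<in> borel_measurable M" if "k \<ge> 1" for k
    using int1[OF that] by (rule borel_measurable_integrable)
  define S where "S = (SUP i\<in>{1..}. \<integral>\<^sup>+ \<omega>. ennreal (\<bar>\<epsilon> i \<omega>\<bar> powr R) \<partial>M)"
  obtain \<mu> where \<mu>: "S = ennreal \<mu>" "\<mu> \<ge> 0"
    using sup[folded S_def] by (cases S) auto
  have nnR: "(\<integral>\<^sup>+ \<omega>. ennreal (\<bar>\<epsilon> k \<omega>\<bar> powr R) \<partial>M) \<le> ennreal \<mu>" if "k \<ge> 1" for k
    unfolding \<mu>(1)[symmetric] S_def using that by (intro SUP_upper) simp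
  have intR: "integrable M (\<lambda>\<omega>. \<bar>\<epsilon> k \<omega>\<bar> powr R)" if "k \<ge> 1" for k
    using rv[OF that] nnR[OF that] by (intro integrableI_bounded) (auto simp: le_less_trans)
  have momR: "expectation (\<lambda>\<omega>. \<bar>\<epsilon> k \<omega>\<bar> powr R) \<le> \<mu>" if "k \<ge> 1" for k
    using nnR[OF that] \<mu>(2) by (subst (asm) nn_integral_eq_integral[OF intR[OF that]]) auto
  have second: "expectation (\<lambda>\<omega>. (\<epsilon> k \<omega>)\<^sup>2) \<le> \<sigma>\<^sup>2" if "k \<ge> 1" for k
    using var[OF that] mean[OF that] by simp

  obtain g where \<Gamma>: "\<And>n. \<Gamma> n = diag_matrix (g n)" and g: "\<And>i. mono (\<lambda>n. g n i)"
    "\<And>i. filterlim (\<lambda>n. g n i) at_top sequentially" "\<And>i. (\<lambda>n. x n $ i / g n i) \<longlonglongrightarrow> 0" "invertible V"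
    "(\<lambda>n. diag_matrix (\<lambda>i. 1 / g n i) ** gram x n ** diag_matrix (\<lambda>i. 1 / g n i)) \<longlonglongrightarrow> matrix_inv V"
    using admissible_normalizationE[OF norm] by blast
  \<comment> \<open>Weights are taken for an arbitrary direction \<open>u\<close>, since the
    characteristic function calls for linear combinations of the \<open>\<alpha> j\<close>.\<close>
  define d where "d u n k = u \<bullet> (\<Gamma> n *v (matrix_inv (gram x n) *v x k))" for u n k
  note weights = ols_weights[OF g, folded \<Gamma>, folded d_def]
  \<comment> \<open>\<open>X n\<close> agrees with the vector of the \<open>\<xi>n n j\<close>
    whenever the Gram matrix is invertible, and it is a weighted error sum for every
    \<open>n\<close>, so moment bounds hold without a rank condition.\<close>
  define X where "X n \<omega> = (\<chi> j. \<Sum>k = 1..n. d (\<alpha> j) n k * \<epsilon> k \<omega>)" for n \<omega>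
  have \<xi>X: "\<xi>n n j \<omega> = X n \<omega> $ j" if "invertible (gram x n)" for n j \<omega>
    unfolding \<xi>n ols_error[OF that] X_def d_def
    by (simp add: linear_sum[OF matrix_vector_mul_linear] matrix_vector_mult_scaleR inner_sum_right mult.commute)
  have Xmeas[measurable]: "X n \<in> borel_measurable M" for n
    unfolding borel_measurable_euclidean_space[of "X n"]
    by (auto simp: Basis_vec_def inner_axis X_def intro!: borel_measurable_sum borel_measurable_times)

  have "\<exists>K. \<forall>n. integrable M (\<lambda>\<omega>. (1 + (X n \<omega> $ j)\<^sup>2) powr (R/2)) \<and> expectation (\<lambda>\<omega>. (1 + (X n \<omega> $ j)\<^sup>2) powr (R/2)) \<le> K" for j
  proof -
    \<comment> \<open>A convergent sequence is bounded over all indices, so the moment bound also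
      covers the early \<open>n\<close>.\<close>
    have "Bseq (\<lambda>n. \<Sum>k = 1..n. (d (\<alpha> j) n k)\<^sup>2)"
      using weights(2) by (intro convergent_imp_Bseq convergentI)
    then obtain b where "\<And>n. norm (\<Sum>k = 1..n. (d (\<alpha> j) n k)\<^sup>2) \<le> b"
      unfolding Bseq_def by blast
    then have b: "(\<Sum>k = 1..n. (d (\<alpha> j) n k)\<^sup>2) \<le> b" for n
      by (metis abs_ge_self order_trans real_norm_def)
    show ?thesis
      using expectation_one_plus_square_powr_weighted_sum[OF R indep int1 mean int2 second intR momR, of b] b unfolding X_def by fastforce
  qed
  then obtain K where K: "\<And>j n. integrable M (\<lambda>\<omega>. (1 + (X n \<omega> $ j)\<^sup>2) powr (R/2))"
    "\<And>j n. expectation (\<lambda>\<omega>. (1 + (X n \<omega> $ j)\<^sup>2) powr (R/2)) \<le> K j" by metis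
  let ?C = "(2 * real CARD('k)) powr (R/2)"
  have R0: "R \<ge> 0" using R by simp
  have intS: "integrable M (\<lambda>\<omega>. ?C * (\<Sum>j\<in>UNIV. (1 + (X n \<omega> $ j)\<^sup>2) powr (R/2)))" for n
    using K by auto
  have intX: "integrable M (\<lambda>\<omega>. (1 + norm (X n \<omega>)) powr R)" for n
    by (rule Bochner_Integration.integrable_bound[OF intS[of n]])
       (auto intro!: AE_I2 order_trans[OF norm_powr_le_sum[OF R0]])
  have boundX: "expectation (\<lambda>\<omega>. (1 + norm (X n \<omega>)) powr R) \<le> ?C * (\<Sum>j\<in>UNIV. K j)" for n
  proof -
    have "expectation (\<lambda>\<omega>. (1 + norm (X n \<omega>)) powr R) \<le> expectation (\<lambda>\<omega>. ?C * (\<Sum>j\<in>UNIV. (1 + (X n \<omega> $ j)\<^sup>2) powr (R/2)))"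
      by (intro integral_mono intX intS norm_powr_le_sum[OF R0])
    also have "\<dots> = ?C * (\<Sum>j\<in>UNIV. expectation (\<lambda>\<omega>. (1 + (X n \<omega> $ j)\<^sup>2) powr (R/2)))"
      using K by simp
    also have "\<dots> \<le> ?C * (\<Sum>j\<in>UNIV. K j)" by (intro mult_left_mono sum_mono K) simp
    finally show ?thesis .
  qed

  \<comment> \<open>The Cramer-Wold reduction: \<open>t \<bullet> X n\<close> is the weighted sum in
    direction \<open>transpose A *v t\<close>, whose limiting variance is the quadratic form of the
    covariance of \<open>\<xi>\<close> at \<open>t\<close>.\<close>
  have cf: "(\<lambda>n. CLINT \<omega>|M. iexp (t \<bullet> X n \<omega>)) \<longlonglongrightarrow> (CLINT \<omega>|N. iexp (t \<bullet> \<xi> \<omega>))" for t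
  proof -
    let ?u = "transpose A *v t"
    have u: "?u = (\<Sum>j\<in>UNIV. t $ j *\<^sub>R \<alpha> j)"
      by (simp only: matrix_vector_column transpose_transpose) (simp add: A scalar_mult_eq_scaleR)
    have tX: "t \<bullet> X n \<omega> = (\<Sum>k = 1..n. d ?u n k * \<epsilon> k \<omega>)" for n \<omega>
    proof -
      have "t \<bullet> X n \<omega> = (\<Sum>j\<in>UNIV. \<Sum>k = 1..n. t $ j * d (\<alpha> j) n k * \<epsilon> k \<omega>)"
        by (simp add: inner_vec_def X_def sum_distrib_left mult.assoc)
      also have "\<dots> = (\<Sum>k = 1..n. \<Sum>j\<in>UNIV. t $ j * d (\<alpha> j) n k * \<epsilon> k \<omega>)" by (rule sum.swap)
      also have "\<dots> = (\<Sum>k = 1..n. d ?u n k * \<epsilon> k \<omega>)"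
        unfolding u d_def by (simp only: inner_sum_left inner_scaleR_left sum_distrib_right)
      finally show ?thesis .
    qed
    have "(CLINT \<omega>|N. iexp (t \<bullet> \<xi> \<omega>)) = (CLINT y|distr N borel \<xi>. iexp (t \<bullet> y))"
      using \<xi>_meas by (subst integral_distr) auto
    also have "\<dots> = exp (complex_of_real (- (t \<bullet> ((\<sigma>\<^sup>2 *\<^sub>R (A ** V ** transpose A)) *v t)) / 2))"
      using \<xi> unfolding multivariate_normal_def by simp
    also have "t \<bullet> ((\<sigma>\<^sup>2 *\<^sub>R (A ** V ** transpose A)) *v t) = \<sigma>\<^sup>2 * (t \<bullet> (A *v (V *v ?u)))"
      by (simp add: scaleR_matrix_vector_assoc[symmetric] matrix_vector_mul_assoc matrix_mul_assoc del: transpose_matrix_vector)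
    also have "t \<bullet> (A *v (V *v ?u)) = ?u \<bullet> (V *v ?u)"
      by (simp add: dot_lmul_matrix[symmetric])
    finally have N': "(CLINT \<omega>|N. iexp (t \<bullet> \<xi> \<omega>)) = complex_of_real (exp (- (\<sigma>\<^sup>2 * (?u \<bullet> (V *v ?u))) / 2))"
      by (simp only: exp_of_real)
    show ?thesis unfolding N' tX
      by (rule lindeberg_char[OF indep int1 mean int2 var tails weights(2) weights(3)])
  qed

  \<comment> \<open>Limits see only large \<open>n\<close>, where the Gram matrix is invertible and
    \<open>X n\<close> may be replaced by the normalized estimation errors. Products of absolute
    powers and monomials both satisfy these growth conditions.\<close>
  have conv: "(\<lambda>n. expectation (\<lambda>\<omega>. f (\<chi> j. \<xi>n n j \<omega>))) \<longlonglongrightarrow> prob_space.expectation N (\<lambda>\<omega>. f (\<xi> \<omega>))"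
    if "continuous_on UNIV f" "\<And>y. \<bar>f y\<bar> \<le> (1 + norm y) powr s" "0 \<le> s" "s < R" for f s
  proof (rule Lim_transform_eventually)
    show "(\<lambda>n. expectation (\<lambda>\<omega>. f (X n \<omega>))) \<longlonglongrightarrow> prob_space.expectation N (\<lambda>\<omega>. f (\<xi> \<omega>))"
      by (rule moment_convergence[OF prob_space_axioms N Xmeas \<xi>_meas cf intX boundX that])
    show "\<forall>\<^sub>F n in sequentially. expectation (\<lambda>\<omega>. f (X n \<omega>)) = expectation (\<lambda>\<omega>. f (\<chi> j. \<xi>n n j \<omega>))"
      using weights(1) by eventually_elim (simp add: \<xi>X)
  qed

  show ?thesis
  proof (intro conjI allI impI; (elim conjE)?)
    fix r :: "'k \<Rightarrow> real" assume r0: "\<forall>j. r j \<ge> 0" and rR: "(\<Sum>j\<in>UNIV. r j) < R"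
    let ?F = "\<lambda>y :: real ^ 'k. \<Prod>j\<in>UNIV. abs_powr (y $ j) (r j)"
    have F: "continuous_on UNIV ?F" using r0 by (intro continuous_on_prod continuous_abs_powr) auto
    have Fb: "\<bar>?F y\<bar> \<le> (1 + norm y) powr (\<Sum>j\<in>UNIV. r j)" for y
      using r0 by (intro prod_powr_bound abs_powr_le) auto
    have s0: "(\<Sum>j\<in>UNIV. r j) \<ge> 0" using r0 by (simp add: sum_nonneg)
    show "(\<lambda>n. expectation (\<lambda>\<omega>. \<Prod>j\<in>UNIV. abs_powr (\<xi>n n j \<omega>) (r j)))
        \<longlonglongrightarrow> prob_space.expectation N (\<lambda>\<omega>. \<Prod>j\<in>UNIV. abs_powr (\<xi> \<omega> $ j) (r j))"
      using conv[OF F Fb s0 rR] by simp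
    let ?I = "{n. design_rank x n = CARD('p)}"
    \<comment> \<open>Uniform integrability involves every full-rank index, so the identification
      with \<open>X n\<close> must hold at each of them and not just eventually.\<close>
    have eq: "(\<Prod>j\<in>UNIV. abs_powr (\<xi>n n j \<omega>) (r j)) = ?F (X n \<omega>)" if "n \<in> ?I" for n \<omega>
      using that by (simp add: \<xi>X design_rank_full_imp_invertible)
    have [measurable]: "?F \<in> borel_measurable borel" using F by (rule borel_measurable_continuous_onI)
    show "uniformly_integrable M ?I (\<lambda>n \<omega>. \<Prod>j\<in>UNIV. abs_powr (\<xi>n n j \<omega>) (r j))"
    proof (rule uniformly_integrable_powr_bound[OF _ intX boundX _ s0 rR])
      show "(\<lambda>\<omega>. \<Prod>j\<in>UNIV. abs_powr (\<xi>n n j \<omega>) (r j)) \<in> borel_measurable M" if "n \<in> ?I" for n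
        unfolding eq[OF that] by (rule measurable_compose[OF Xmeas]) fact
      show "\<bar>\<Prod>j\<in>UNIV. abs_powr (\<xi>n n j \<omega>) (r j)\<bar> \<le> (1 + norm (X n \<omega>)) powr (\<Sum>j\<in>UNIV. r j)" if "n \<in> ?I" for n \<omega>
        unfolding eq[OF that] by (rule Fb)
    qed
  next
    fix q :: "'k \<Rightarrow> nat" assume qR: "(\<Sum>j\<in>UNIV. real (q j)) < R"
    let ?F = "\<lambda>y :: real ^ 'k. \<Prod>j\<in>UNIV. (y $ j) ^ q j"
    have F: "continuous_on UNIV ?F" by (intro continuous_intros)
    have Fb: "\<bar>?F y\<bar> \<le> (1 + norm y) powr (\<Sum>j\<in>UNIV. real (q j))" for y
      by (intro prod_powr_bound power_le_powr) auto
    show "(\<lambda>n. expectation (\<lambda>\<omega>. \<Prod>j\<in>UNIV. \<xi>n n j \<omega> ^ q j))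
        \<longlonglongrightarrow> prob_space.expectation N (\<lambda>\<omega>. \<Prod>j\<in>UNIV. (\<xi> \<omega> $ j) ^ q j)"
      using conv[OF F Fb _ qR] by (simp add: sum_nonneg)
  qed
qed

end
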